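(* Let $E$ be a separable Banach space and $F$ a Gaussian random element in $E$ with mean $m$, covariance operator $C\colon E^*\to E$ and law $P$. Let $L_1,\dots,L_M\in E^*$, $L=(L_1,\dots,L_M)\colon E\to\mathbb{R}^M$, $U=((F,L_m)_E)_{m=1}^M$, and assume $C_{LL}$ is invertible, so that the law of $U$ is $P^L=\mathcal{N}((m,L)_E,C_{LL})$. Let $Q^L=\mathcal{N}(\mu,\Sigma)$ with $\mu\in\mathbb{R}^M$ and $\Sigma\in\mathbb{R}^{M\times M}$ positive definite, and define the measure $Q$ on $\mathcal{B}(E)$ by $Q(A)=\int_A\big(\frac{dQ^L}{dP^L}\circ L\big)(f)\,dP(f)$. Then: (1) For every $A\in\mathcal{B}(E)$, $Q(A)=\int_{\mathbb{R}^M}\mathbb{P}(F\in A\mid U=u)\,dQ^L(u)$. (2) $Q$ is a Gaussian measure with mean $m_Q$ satisfying $$(m_Q,T)_E=(m,T)_E+C_{TL}C_{LL}^{-1}\big(\mu-(m,L)_E\big)$$ for all $T\in E^*$, and covariance operator $C_Q$ satisfying $$(C_QT,T')_E=(CT,T')_E+C_{TL}C_{LL}^{-1}(\Sigma-C_{LL})C_{LL}^{-1}C_{LT'}$$ for all $T,T'\in E^*$.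
   Context: $(y,x^* )_E:=x^*(y)$ for $x^*\in E^*$. A Gaussian random element $F$ in $E$ is a measurable map with $(F,x^* )_E$ Gaussian for all $x^*\in E^*$; mean $m$: $(m,x^* )_E=\mathbb{E}[(F,x^* )_E]$; covariance operator: $(Cx^*,y^* )_E=\mathrm{Cov}[(F,x^* )_E,(F,y^* )_E]$. A Gaussian measure on $E$ is one whose pushforward under each $x^*\in E^*$ is Gaussian. Notation: $(m,L)_E=((m,L_m)_E)_m$, $(C_{LL})_{mm'}=(CL_m,L_{m'})_E$, $(C_{TL})_{1,m}=(CT,L_m)_E$, $C_{LT'}=C_{T'L}^\top$. $\mathbb{P}(F\in A\mid U=u)$ is the regular conditional distribution of $F$ given $U=u$ under the prior. *)

theory Defs
  imports "HOL-Probability.Probability"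
begin

definition real_gaussian :: "real measure \<Rightarrow> bool" where
  "real_gaussian N \<longleftrightarrow>
     (\<exists>\<mu> \<sigma>. \<sigma> > 0 \<and> N = density lborel (\<lambda>x. ennreal (normal_density \<mu> \<sigma> x)))
   \<or> (\<exists>\<mu>. N = return borel \<mu>)"

definition gaussian_measure :: "'e::real_normed_vector measure \<Rightarrow> bool" where
  "gaussian_measure P \<longleftrightarrow> sets P = sets borel \<and> prob_space P \<and>
     (\<forall>x::'e \<Rightarrow>\<^sub>L real. real_gaussian (distr P borel (blinfun_apply x)))"

definition gaussian_random_element :: "'a measure \<Rightarrow> ('a \<Rightarrow> 'e::real_normed_vector) \<Rightarrow> bool" where
  "gaussian_random_element M F \<longleftrightarrow> prob_space M \<and> F \<in> borel_measurable M \<and>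
     (\<forall>x::'e \<Rightarrow>\<^sub>L real. real_gaussian (distr M borel (\<lambda>\<omega>. blinfun_apply x (F \<omega>))))"

definition is_mean_re :: "'a measure \<Rightarrow> ('a \<Rightarrow> 'e::real_normed_vector) \<Rightarrow> 'e \<Rightarrow> bool" where
  "is_mean_re M F m \<longleftrightarrow> (\<forall>x::'e \<Rightarrow>\<^sub>L real.
     integrable M (\<lambda>\<omega>. blinfun_apply x (F \<omega>)) \<and> blinfun_apply x m = (\<integral>\<omega>. blinfun_apply x (F \<omega>) \<partial>M))"

definition is_cov_re :: "'a measure \<Rightarrow> ('a \<Rightarrow> 'e::real_normed_vector) \<Rightarrow> 'e
     \<Rightarrow> (('e \<Rightarrow>\<^sub>L real) \<Rightarrow> 'e) \<Rightarrow> bool" where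
  "is_cov_re M F m C \<longleftrightarrow> (\<forall>x y::'e \<Rightarrow>\<^sub>L real.
     integrable M (\<lambda>\<omega>. (blinfun_apply x (F \<omega>) - blinfun_apply x m) * (blinfun_apply y (F \<omega>) - blinfun_apply y m)) \<and>
     blinfun_apply y (C x) = (\<integral>\<omega>. (blinfun_apply x (F \<omega>) - blinfun_apply x m) * (blinfun_apply y (F \<omega>) - blinfun_apply y m) \<partial>M))"

definition is_mean_measure :: "'e::real_normed_vector measure \<Rightarrow> 'e \<Rightarrow> bool" where
  "is_mean_measure Q m \<longleftrightarrow> is_mean_re Q (\<lambda>f. f) m"

definition is_cov_measure :: "'e::real_normed_vector measure \<Rightarrow> 'e \<Rightarrow> (('e \<Rightarrow>\<^sub>L real) \<Rightarrow> 'e) \<Rightarrow> bool" where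
  "is_cov_measure Q m C \<longleftrightarrow> is_cov_re Q (\<lambda>f. f) m C"

definition pos_def_matrix :: "real^'m^'m \<Rightarrow> bool" where
  "pos_def_matrix S \<longleftrightarrow> transpose S = S \<and> (\<forall>x. x \<noteq> 0 \<longrightarrow> x \<bullet> (S *v x) > 0)"

definition mvn_density :: "real^'m::finite \<Rightarrow> real^'m^'m \<Rightarrow> real^'m \<Rightarrow> real" where
  "mvn_density \<mu> S x =
     exp (- ((x - \<mu>) \<bullet> (matrix_inv S *v (x - \<mu>))) / 2) / sqrt ((2 * pi) ^ CARD('m) * det S)"

definition mvn :: "real^'m::finite \<Rightarrow> real^'m^'m \<Rightarrow> (real^'m) measure" where
  "mvn \<mu> S = density lborel (\<lambda>x. ennreal (mvn_density \<mu> S x))"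

definition reg_cond_distr :: "'a measure \<Rightarrow> ('a \<Rightarrow> 'e::topological_space) \<Rightarrow> ('a \<Rightarrow> 'u::topological_space)
     \<Rightarrow> ('u \<Rightarrow> 'e measure) \<Rightarrow> bool" where
  "reg_cond_distr M F U \<kappa> \<longleftrightarrow>
     (\<forall>u. prob_space (\<kappa> u) \<and> sets (\<kappa> u) = sets borel) \<and>
     (\<forall>A \<in> sets borel. (\<lambda>u. measure (\<kappa> u) A) \<in> borel_measurable borel) \<and>
     (\<forall>A \<in> sets borel. \<forall>B \<in> sets borel.
        measure M {\<omega> \<in> space M. F \<omega> \<in> A \<and> U \<omega> \<in> B}
          = (\<integral>u. indicator B u * measure (\<kappa> u) A \<partial>(distr M borel U)))"

end

theory Submission
  imports Defs
begin

text \<open>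
  For a functional \<open>T\<close> put \<open>R = T - a \<bullet> L\<close> with \<open>a = C\<^sub>L\<^sub>L\<^sup>-\<^sup>1 C\<^sub>L\<^sub>T\<close>. Then \<open>R(F)\<close> and
  \<open>L(F)\<close> are jointly Gaussian and uncorrelated, so comparing characteristic functions shows that
  their joint law is the product of a normal law and \<open>P\<^sup>L\<close>. Reweighting by \<open>dQ\<^sup>L/dP\<^sup>L\<close>, a function of
  \<open>L(F)\<close> alone, turns this into the same normal law times \<open>Q\<^sup>L\<close>. Under \<open>Q\<close> the functional
  \<open>T = R + a \<bullet> L\<close> is therefore a sum of independent Gaussians, and mean and variance are read off;
  covariances follow by polarization.
\<close>

section \<open>Characteristic functions determine finite measures\<close>

text \<open>Gaussianity is given only functional by functional, so no joint law is available at the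
  outset. The way round is that \<open>s *\<^sub>R R + t \<bullet> L\<close> is again a continuous
  functional on E: its one-dimensional law, evaluated at frequency 1, gives the joint characteristic
  function of (R(F), L(F)) at (s, t). Turning this into an identity of measures needs two
  ingredients: uniqueness for characteristic functions of several variables, reduced here to one
  variable, and the characteristic function of the normal law given by its density, obtained from a
  factorization S = A A^T of the covariance matrix and a linear change of variables. Mean and
  covariance of Q are built explicitly from m and values of C, so no integral with values in E
  appears. Statement (1) rests on a different fact: the law of U restricted to the event F \<in> A
  has the density u -> P(F \<in> A | U = u) with respect to P^L.\<close>

definition charfn :: "'a::euclidean_space measure \<Rightarrow> 'a \<Rightarrow> complex" where
  "charfn N t = (CLINT x|N. iexp (t \<bullet> x))"

text \<open>The value at 0 of the characteristic function is the total mass, so both masses agree.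
  If the common mass is positive, dividing by it reduces the claim to Levy uniqueness for
  probability measures. Finite measures of arbitrary mass are needed because weighted laws are
  compared below.\<close>

lemma finite_measure_eqI_char:
  fixes N1 N2 :: "real measure"
  assumes "finite_measure N1" "finite_measure N2"
    and sets: "sets N1 = sets borel" "sets N2 = sets borel"
    and char: "\<And>t. char N1 t = char N2 t"
  shows "N1 = N2"
proof -
  interpret N1: finite_measure N1 by fact
  interpret N2: finite_measure N2 by fact
  have space: "space N1 = UNIV" "space N2 = UNIV"
    using sets[THEN sets_eq_imp_space_eq] by auto
  define c where "c = measure N1 UNIV"
  have "char N1 0 = of_real (measure N1 UNIV)" "char N2 0 = of_real (measure N2 UNIV)"
    by (simp_all add: char_def space scaleR_conv_of_real)
  with char[of 0] have c2: "measure N2 UNIV = c"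
    by (simp add: c_def)
  show ?thesis
  proof (cases "c = 0")
    case True
    have "emeasure N1 A = 0" "emeasure N2 A = 0" for A
      using True c2 N1.emeasure_eq_measure N2.emeasure_eq_measure
        N1.bounded_measure[of A] N2.bounded_measure[of A] by (auto simp: c_def space measure_le_0_iff)
    then show ?thesis using sets by (intro measure_eqI) auto
  next
    case False
    then have "c > 0" by (simp add: c_def zero_less_measure_iff)
    define D where "D N = density N (\<lambda>_::real. ennreal (1 / c))" for N
    have D: "real_distribution (D N) \<and> (\<forall>t. char (D N) t = char N t / c)"
      if "sets N = sets borel" "finite_measure N" "measure N UNIV = c" for N
    proof -
      interpret finite_measure N by fact
      have [simp]: "space N = UNIV" using sets_eq_imp_space_eq[OF that(1)] by simp
      have "emeasure (D N) UNIV = 1"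
        using \<open>c > 0\<close> that by (simp add: D_def emeasure_density nn_integral_cmult
            emeasure_eq_measure ennreal_mult[symmetric])
      then have "prob_space (D N)"
        by (intro prob_spaceI) (simp add: D_def)
      moreover have "char (D N) t = char N t / c" for t
      proof -
        have [measurable_cong]: "sets N = sets borel" by fact
        show ?thesis
          unfolding char_def D_def using \<open>c > 0\<close>
          by (subst integral_density) (auto simp: scaleR_conv_of_real divide_inverse mult.commute)
      qed
      ultimately show ?thesis
        by (simp add: real_distribution_def real_distribution_axioms_def D_def that)
    qed
    have "D N1 = D N2"
      using D[OF sets(1) assms(1)] D[OF sets(2) assms(2) c2] char
      by (intro Levy_uniqueness) (auto simp: c_def)
    have "density (D N) (\<lambda>_. ennreal c) = N" for N
      using \<open>c > 0\<close> by (simp add: D_def density_density_eq ennreal_mult[symmetric] density_1)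
    then show ?thesis using \<open>D N1 = D N2\<close> by metis
  qed
qed

text \<open>The hypothesis says that the measures with density \<open>h\<close>, projected to the
  direction \<open>b\<close>, have equal one-dimensional characteristic functions; hence the
  projections coincide. Nonnegativity of \<open>h\<close> makes them measures and the bound
  \<open>K\<close> makes them finite.\<close>

lemma weighted_projection_eqI:
  fixes N1 N2 :: "'a::euclidean_space measure" and h :: "'a \<Rightarrow> real"
  assumes fin: "finite_measure N1" "finite_measure N2"
    and sets: "sets N1 = sets borel" "sets N2 = sets borel"
    and h: "h \<in> borel_measurable borel" "\<And>x. 0 \<le> h x" "\<And>x. h x \<le> K"
    and eq: "\<And>s. (CLINT x|N1. h x * iexp (s * (x \<bullet> b))) = (CLINT x|N2. h x * iexp (s * (x \<bullet> b)))"
    and B: "B \<in> sets borel"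
  shows "(LINT x|N1. h x * indicator B (x \<bullet> b)) = (LINT x|N2. h x * indicator B (x \<bullet> b))"
proof -
  note h(1)[measurable] B[measurable]
  define D where "D N = distr (density N h) borel (\<lambda>x. x \<bullet> b)" for N
  have D: "finite_measure (D N) \<and> (\<forall>s. char (D N) s = (CLINT x|N. h x * iexp (s * (x \<bullet> b))))
      \<and> measure (D N) B = (LINT x|N. h x * indicator B (x \<bullet> b))"
    if "finite_measure N" "sets N = sets borel" for N
  proof -
    interpret finite_measure N by fact
    have [measurable_cong]: "sets N = sets borel" by fact
    have [simp]: "space N = UNIV" using sets_eq_imp_space_eq[OF that(2)] by simp
    have "emeasure (density N h) UNIV \<le> (\<integral>\<^sup>+x. ennreal K \<partial>N)"
      by (subst emeasure_density) (auto intro!: nn_integral_mono ennreal_leI h simp del: nn_integral_const)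
    also have "\<dots> < \<infinity>"
      using emeasure_finite[of UNIV] by (auto simp: ennreal_mult_eq_top_iff less_top[symmetric])
    finally have f: "finite_measure (density N h)"
      by (intro finite_measureI) auto
    interpret d: finite_measure "density N h" by fact
    have "finite_measure (D N)"
      unfolding D_def by (rule d.finite_measure_distr) simp
    moreover have "char (D N) s = (CLINT x|N. h x * iexp (s * (x \<bullet> b)))" for s
      unfolding char_def D_def using h(2)
      by (subst integral_distr, simp, simp, subst integral_density) (auto simp: scaleR_conv_of_real)
    moreover have "measure (D N) B = (LINT x|N. h x * indicator B (x \<bullet> b))"
    proof -
      have "measure (D N) B = (LINT y|D N. indicator B y)"
        by (simp add: D_def)
      also have "\<dots> = (LINT x|N. h x * indicator B (x \<bullet> b))"
        unfolding D_def using h(2)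
        by (subst integral_distr, simp, simp, subst integral_density) auto
      finally show ?thesis .
    qed
    ultimately show ?thesis by blast
  qed
  have "D N1 = D N2"
    using D[OF fin(1) sets(1)] D[OF fin(2) sets(2)] eq
    by (intro finite_measure_eqI_char) (auto simp: D_def)
  then show ?thesis
    using D[OF fin(1) sets(1)] D[OF fin(2) sets(2)] by simp
qed

lemma of_real_cos_iexp: "of_real (cos y) = (iexp y + iexp (- y)) / 2"
  and of_real_sin_iexp: "of_real (sin y) = (iexp y - iexp (- y)) / (2 * \<i>)"
  by (simp_all add: complex_eq_iff Re_exp Im_exp Re_divide Im_divide power2_eq_square)

lemma iexp_cos_sin: "iexp y = of_real (cos y) + \<i> * of_real (sin y)"
  by (simp add: complex_eq_iff Re_exp Im_exp)

text \<open>
  Coordinates are replaced one at a time. The weights \<open>1 + cos\<close> and \<open>1 + sin\<close> are nonnegative, so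
  that the one-dimensional uniqueness theorem applies to the weighted measures, and
  together they recover the complex exponential.
\<close>

lemma charfn_box_eq:
  fixes N1 N2 :: "'a::euclidean_space measure" and B :: "'a \<Rightarrow> real set"
  assumes fin: "finite_measure N1" "finite_measure N2"
    and sets: "sets N1 = sets borel" "sets N2 = sets borel"
    and eq: "\<And>t. charfn N1 t = charfn N2 t"
    and B: "\<And>b. B b \<in> sets borel" and "finite S"
  shows "(CLINT x|N1. of_real (\<Prod>b\<in>S. indicator (B b) (x \<bullet> b)) * iexp (t \<bullet> x)) =
    (CLINT x|N2. of_real (\<Prod>b\<in>S. indicator (B b) (x \<bullet> b)) * iexp (t \<bullet> x))"
  using \<open>finite S\<close>
proof (induction S arbitrary: t)
  case empty
  then show ?case using eq by (simp add: charfn_def)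
next
  case (insert b S)
  define p where "p x = (\<Prod>b\<in>S. indicator (B b) (x \<bullet> b) :: real)" for x
  note B[measurable]
  have p [measurable]: "p \<in> borel_measurable borel"
    unfolding p_def by measurable
  have p01: "0 \<le> p x" "p x \<le> 1" for x
    unfolding p_def by (auto intro!: prod_nonneg prod_le_1)
  have IH: "(CLINT x|N1. p x * iexp (t \<bullet> x)) = (CLINT x|N2. p x * iexp (t \<bullet> x))" for t
    using insert.IH by (simp add: p_def)
  have int: "integrable N (\<lambda>x. p x * iexp (t \<bullet> x))"
    if "finite_measure N" "sets N = sets borel" for N t
  proof -
    interpret finite_measure N by fact
    have [measurable_cong]: "sets N = sets borel" by fact
    show ?thesis
      by (rule integrable_const_bound[of _ 1]) (use p01 in \<open>auto simp: norm_mult\<close>)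
  qed
  define g where "g t x = complex_of_real (p x) * iexp (t \<bullet> x)" for t x
  have int_g: "integrable N1 (g t)" "integrable N2 (g t)" for t
    using int[OF fin(1) sets(1)] int[OF fin(2) sets(2)] by (simp_all add: g_def[abs_def])
  have IH_g: "(CLINT x|N1. g t x) = (CLINT x|N2. g t x)" for t
    using IH by (simp add: g_def)
  \<comment> \<open>The weight without a trigonometric factor is what \<open>split\<close> subtracts
    later, in order to pass from \<open>1 + cos\<close> and \<open>1 + sin\<close> back to
    \<open>cos\<close> and \<open>sin\<close>.\<close>
  have w0: "(LINT x|N1. p x * indicator (B b) (x \<bullet> b)) = (LINT x|N2. p x * indicator (B b) (x \<bullet> b))"
    by (rule weighted_projection_eqI[OF fin sets, where K=1])
       (use p01 IH[of "s *\<^sub>R b" for s] in \<open>auto simp: inner_commute\<close>)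
  have wc: "(LINT x|N1. (p x * (1 + cos (t \<bullet> x))) * indicator (B b) (x \<bullet> b)) =
      (LINT x|N2. (p x * (1 + cos (t \<bullet> x))) * indicator (B b) (x \<bullet> b))"
  proof (rule weighted_projection_eqI[OF fin sets, where K=2])
    show "(\<lambda>x. p x * (1 + cos (t \<bullet> x))) \<in> borel_measurable borel" by measurable
    show "0 \<le> p x * (1 + cos (t \<bullet> x))" for x
      using p01[of x] cos_ge_minus_one[of "t \<bullet> x"] by (intro mult_nonneg_nonneg) linarith+
    show "p x * (1 + cos (t \<bullet> x)) \<le> 2" for x
    proof -
      have "p x * (1 + cos (t \<bullet> x)) \<le> 1 * 2"
        using p01[of x] cos_ge_minus_one[of "t \<bullet> x"] cos_le_one[of "t \<bullet> x"]
        by (intro mult_mono) linarith+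
      then show ?thesis by simp
    qed
    fix s
    \<comment> \<open>Multiplication by a cosine only shifts the frequency by \<open>t\<close> and
      \<open>- t\<close>. Each summand is thus covered by the induction hypothesis at another
      frequency, which is why \<open>t\<close> is kept arbitrary in the induction.\<close>
    have *: "of_real (p x * (1 + cos (t \<bullet> x))) * iexp (s * (x \<bullet> b)) =
        g (s *\<^sub>R b) x + (g (s *\<^sub>R b + t) x + g (s *\<^sub>R b - t) x) / 2" for x
      unfolding g_def of_real_mult of_real_add of_real_cos_iexp
      by (simp add: inner_commute algebra_simps exp_add[symmetric] add_divide_distrib)
    show "(CLINT x|N1. of_real (p x * (1 + cos (t \<bullet> x))) * iexp (s * (x \<bullet> b))) =
        (CLINT x|N2. of_real (p x * (1 + cos (t \<bullet> x))) * iexp (s * (x \<bullet> b)))"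
      unfolding * by (simp add: int_g IH_g)
  qed (use B in auto)
  have ws: "(LINT x|N1. (p x * (1 + sin (t \<bullet> x))) * indicator (B b) (x \<bullet> b)) =
      (LINT x|N2. (p x * (1 + sin (t \<bullet> x))) * indicator (B b) (x \<bullet> b))"
  proof (rule weighted_projection_eqI[OF fin sets, where K=2])
    show "(\<lambda>x. p x * (1 + sin (t \<bullet> x))) \<in> borel_measurable borel" by measurable
    show "0 \<le> p x * (1 + sin (t \<bullet> x))" for x
      using p01[of x] sin_ge_minus_one[of "t \<bullet> x"] by (intro mult_nonneg_nonneg) linarith+
    show "p x * (1 + sin (t \<bullet> x)) \<le> 2" for x
    proof -
      have "p x * (1 + sin (t \<bullet> x)) \<le> 1 * 2"
        using p01[of x] sin_ge_minus_one[of "t \<bullet> x"] sin_le_one[of "t \<bullet> x"]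
        by (intro mult_mono) linarith+
      then show ?thesis by simp
    qed
    fix s
    have *: "of_real (p x * (1 + sin (t \<bullet> x))) * iexp (s * (x \<bullet> b)) =
        g (s *\<^sub>R b) x + (g (s *\<^sub>R b + t) x - g (s *\<^sub>R b - t) x) / (2 * \<i>)" for x
      unfolding g_def of_real_mult of_real_add of_real_sin_iexp
      by (simp add: inner_commute algebra_simps exp_add[symmetric] diff_divide_distrib)
    show "(CLINT x|N1. of_real (p x * (1 + sin (t \<bullet> x))) * iexp (s * (x \<bullet> b))) =
        (CLINT x|N2. of_real (p x * (1 + sin (t \<bullet> x))) * iexp (s * (x \<bullet> b)))"
      unfolding * by (simp add: int_g IH_g)
  qed (use B in auto)
  have split: "(CLINT x|N. of_real (\<Prod>b\<in>insert b S. indicator (B b) (x \<bullet> b)) * iexp (t \<bullet> x)) =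
      of_real ((LINT x|N. (p x * (1 + cos (t \<bullet> x))) * indicator (B b) (x \<bullet> b)) - (LINT x|N. p x * indicator (B b) (x \<bullet> b)))
      + \<i> * of_real ((LINT x|N. (p x * (1 + sin (t \<bullet> x))) * indicator (B b) (x \<bullet> b)) - (LINT x|N. p x * indicator (B b) (x \<bullet> b)))"
    if "finite_measure N" "sets N = sets borel" for N
  proof -
    interpret finite_measure N by fact
    have [measurable_cong]: "sets N = sets borel" by fact
    have bd: "integrable N (\<lambda>x. p x * g x * indicator (B b) (x \<bullet> b))"
      if [measurable]: "g \<in> borel_measurable borel" and "\<And>x. \<bar>g x\<bar> \<le> 2" for g :: "'a \<Rightarrow> real"
    proof (rule integrable_const_bound[of _ 2])
      have "\<bar>p x * g x\<bar> \<le> 1 * 2" for x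
        unfolding abs_mult by (rule mult_mono) (use p01 that in auto)
      then show "AE x in N. norm (p x * g x * indicator (B b) (x \<bullet> b)) \<le> 2"
        by (auto split: split_indicator)
    qed simp
    have c2: "\<bar>1 + cos y\<bar> \<le> 2" "\<bar>1 + sin y\<bar> \<le> 2" "\<bar>cos y\<bar> \<le> 2" "\<bar>sin y\<bar> \<le> 2" for y :: real
      by (insert cos_ge_minus_one[of y] cos_le_one[of y] sin_ge_minus_one[of y] sin_le_one[of y], linarith+)
    have i0: "integrable N (\<lambda>x. p x * indicator (B b) (x \<bullet> b))" using bd[of "\<lambda>_. 1"] by simp
    have ic1: "integrable N (\<lambda>x. p x * (1 + cos (t \<bullet> x)) * indicator (B b) (x \<bullet> b))"
      and is1: "integrable N (\<lambda>x. p x * (1 + sin (t \<bullet> x)) * indicator (B b) (x \<bullet> b))"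
      and ic: "integrable N (\<lambda>x. p x * cos (t \<bullet> x) * indicator (B b) (x \<bullet> b))"
      and is0: "integrable N (\<lambda>x. p x * sin (t \<bullet> x) * indicator (B b) (x \<bullet> b))"
      by (rule bd; use c2 in simp)+
    have "(CLINT x|N. of_real (\<Prod>b\<in>insert b S. indicator (B b) (x \<bullet> b)) * iexp (t \<bullet> x)) =
      (CLINT x|N. of_real (p x * cos (t \<bullet> x) * indicator (B b) (x \<bullet> b))
        + \<i> * of_real (p x * sin (t \<bullet> x) * indicator (B b) (x \<bullet> b)))"
      using insert.hyps by (intro Bochner_Integration.integral_cong refl)
        (simp add: iexp_cos_sin p_def[symmetric] algebra_simps)
    also have "\<dots> = of_real (LINT x|N. p x * cos (t \<bullet> x) * indicator (B b) (x \<bullet> b))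
        + \<i> * of_real (LINT x|N. p x * sin (t \<bullet> x) * indicator (B b) (x \<bullet> b))"
      using ic is0 by (subst Bochner_Integration.integral_add)
        (auto simp del: of_real_mult simp: integrable_of_real)
    also have "(LINT x|N. p x * cos (t \<bullet> x) * indicator (B b) (x \<bullet> b)) =
        (LINT x|N. (p x * (1 + cos (t \<bullet> x))) * indicator (B b) (x \<bullet> b)) - (LINT x|N. p x * indicator (B b) (x \<bullet> b))"
      by (subst Bochner_Integration.integral_diff[symmetric, OF ic1 i0]) (simp add: algebra_simps)
    also have "(LINT x|N. p x * sin (t \<bullet> x) * indicator (B b) (x \<bullet> b)) =
        (LINT x|N. (p x * (1 + sin (t \<bullet> x))) * indicator (B b) (x \<bullet> b)) - (LINT x|N. p x * indicator (B b) (x \<bullet> b))"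
      by (subst Bochner_Integration.integral_diff[symmetric, OF is1 i0]) (simp add: algebra_simps)
    finally show ?thesis .
  qed
  show ?case
    unfolding split[OF fin(1) sets(1)] split[OF fin(2) sets(2)] w0 wc ws ..
qed

text \<open>Open boxes form an intersection-stable generator of the Borel sets, and the indicator of
  a box is the product of the indicators of its sides. With all basis directions and frequency 0,
  \<open>charfn_box_eq\<close> therefore compares the measures of boxes.\<close>

theorem finite_measure_eqI_charfn:
  fixes N1 N2 :: "'a::euclidean_space measure"
  assumes fin: "finite_measure N1" "finite_measure N2"
    and sets: "sets N1 = sets borel" "sets N2 = sets borel"
    and eq: "\<And>t. charfn N1 t = charfn N2 t"
  shows "N1 = N2"
proof (rule measure_eqI_generator_eq)
  let ?E = "range (\<lambda>(a, b). box a b :: 'a set)"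
  show "Int_stable ?E"
    by (auto simp: Int_stable_def box_Int_box)
  show "?E \<subseteq> Pow UNIV" "sets N1 = sigma_sets UNIV ?E" "sets N2 = sigma_sets UNIV ?E"
    by (simp_all add: borel_eq_box sets)
  let ?A = "\<lambda>n::nat. box (- (real n *\<^sub>R One)) (real n *\<^sub>R One) :: 'a set"
  show "range ?A \<subseteq> ?E" "(\<Union>i. ?A i) = UNIV"
    unfolding UN_box_eq_UNIV by auto
  show "emeasure N1 (?A i) \<noteq> \<infinity>" for i
    using finite_measure.emeasure_finite[OF fin(1)] by auto
  fix X assume "X \<in> ?E"
  then obtain l u where X: "X = box l u" by auto
  have ind: "(\<Prod>b\<in>Basis. indicator {l \<bullet> b<..<u \<bullet> b} (x \<bullet> b)) = (indicator X x :: real)" for x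
    by (auto simp: X mem_box indicator_def prod_zero_iff)
  have "measure N X = (CLINT x|N. of_real (\<Prod>b\<in>Basis. indicator {l \<bullet> b<..<u \<bullet> b} (x \<bullet> b)) * iexp (0 \<bullet> x))"
    if "finite_measure N" "sets N = sets borel" for N
  proof -
    interpret finite_measure N by fact
    have [simp]: "space N = UNIV" using sets_eq_imp_space_eq[OF that(2)] by simp
    show ?thesis unfolding ind using that(2) by (simp add: X)
  qed
  from this[OF fin(1) sets(1)] this[OF fin(2) sets(2)]
  have "complex_of_real (measure N1 X) = of_real (measure N2 X)"
    using charfn_box_eq[OF fin sets eq, of "\<lambda>b. {l \<bullet> b<..<u \<bullet> b}" Basis 0] by simp
  then show "emeasure N1 X = emeasure N2 X"
    using fin by (simp add: finite_measure.emeasure_eq_measure)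
qed

section \<open>Multivariate normal distributions\<close>

interpretation lborel_prod: product_sigma_finite "\<lambda>_::'k. lborel :: real measure"
  by standard

text \<open>\<open>matrix_inv\<close> is a choice among two-sided inverses. For square matrices a
  right inverse is also a left inverse, and this pins the choice down.\<close>

lemma matrix_inv_unique:
  fixes A B :: "real^'k::finite^'k"
  assumes "A ** B = mat 1"
  shows "matrix_inv A = B"
proof -
  have BA: "B ** A = mat 1" using assms by (simp add: matrix_left_right_inverse)
  have "A ** matrix_inv A = mat 1 \<and> matrix_inv A ** A = mat 1"
    unfolding matrix_inv_def by (rule someI[of _ B]) (simp add: assms BA)
  then show ?thesis
    by (metis BA matrix_mul_assoc matrix_mul_lid matrix_mul_rid)
qed

lemma inner_transpose_matrix: "(transpose A *v x) \<bullet> y = x \<bullet> (A *v y)" for A :: "real^'k::finite^'n::finite"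
  by (simp add: dot_lmul_matrix)

lemma borel_measurable_matrix_vector_mult [measurable (raw)]:
  fixes A :: "real^'k::finite^'n::finite"
  assumes "f \<in> borel_measurable M"
  shows "(\<lambda>x. A *v f x) \<in> borel_measurable M"
  by (rule measurable_compose[OF assms])
     (intro borel_measurable_continuous_onI matrix_vector_mult_linear_continuous_on)

section \<open>Lebesgue measure on vectors and linear change of variables\<close>

lemma prod_Basis_vec:
  fixes g :: "real^'k::finite \<Rightarrow> 'c::comm_monoid_mult"
  shows "(\<Prod>b\<in>Basis. g b) = (\<Prod>i\<in>UNIV. g (axis i 1))"
proof -
  have inj: "inj (\<lambda>i::'k. axis i 1 :: real^'k)"
    by (auto simp: inj_on_def axis_eq_axis)
  have "(Basis :: (real^'k) set) = range (\<lambda>i. axis i 1)"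
    by (auto simp: Basis_vec_def)
  then have "prod g Basis = prod g (range (\<lambda>i. axis i 1))" by (simp only:)
  then show ?thesis using prod.reindex[OF inj, of g] by (simp add: o_def)
qed

lemma measurable_vec_lambda_PiM [measurable]:
  "(\<lambda>x. \<chi> i. x i) \<in> borel_measurable (\<Pi>\<^sub>M i\<in>(UNIV::'k::finite set). (lborel :: real measure))"
  by (subst borel_measurable_euclidean_space) (auto simp: Basis_vec_def inner_axis)

text \<open>Lebesgue measure is determined by its values on boxes, and a box pulls back to a product
  of intervals. This gives access to Fubini in a single coordinate and to integrals of
  products.\<close>

lemma lborel_vec_eq:
  "lborel = distr (\<Pi>\<^sub>M i\<in>(UNIV::'k::finite set). lborel) borel (\<lambda>x. \<chi> i. (x i :: real))"
proof (rule lborel_eqI)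
  fix l u :: "real^'k"
  assume b: "\<And>b. b \<in> Basis \<Longrightarrow> l \<bullet> b \<le> u \<bullet> b"
  have le: "l $ i \<le> u $ i" for i
    using b[of "axis i 1"] by (simp add: inner_axis)
  have "(\<lambda>x. \<chi> i. x i) -` box l u \<inter> space (\<Pi>\<^sub>M i\<in>(UNIV::'k set). lborel) =
      (\<Pi>\<^sub>E i\<in>UNIV. {l $ i <..< u $ i})"
    by (auto simp: mem_box_cart space_PiM PiE_def Pi_def)
  then show "emeasure (distr (\<Pi>\<^sub>M i\<in>(UNIV::'k set). lborel) borel (\<lambda>x. \<chi> i. x i)) (box l u) =
      ennreal (\<Prod>b\<in>Basis. (u - l) \<bullet> b)"
    using le by (simp add: emeasure_distr lborel_prod.emeasure_PiM prod_ennreal prod_Basis_vec inner_axis)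
qed simp

lemma nn_integral_lborel_vec:
  fixes f :: "real^'k::finite \<Rightarrow> ennreal"
  assumes "f \<in> borel_measurable borel"
  shows "(\<integral>\<^sup>+x. f x \<partial>lborel) = (\<integral>\<^sup>+x. f (\<chi> i. x i) \<partial>(\<Pi>\<^sub>M i\<in>UNIV. lborel))"
  using assms by (subst lborel_vec_eq) (simp add: nn_integral_distr)

text \<open>
  The change of variables in \<open>HOL-Analysis\<close> requires a well-ordered index type.
\<close>

lemma nn_integral_lborel_linear:
  fixes A :: "real^'k::finite^'k"
  shows "det A \<noteq> 0 \<longrightarrow> (\<forall>f\<in>borel_measurable borel.
    (\<integral>\<^sup>+x. f x \<partial>lborel) = ennreal \<bar>det A\<bar> * (\<integral>\<^sup>+x. f (A *v x) \<partial>lborel))"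
\<comment> \<open>The formula is stable under matrix products, so elementary matrices suffice. A
  matrix with a zero row has determinant 0 and satisfies the implication vacuously.\<close>
proof (induction A rule: induct_matrix_elementary)
  case (1 A B)
  show ?case
  proof (intro impI ballI)
    fix f :: "real^'k \<Rightarrow> ennreal"
    assume "det (A ** B) \<noteq> 0" and [measurable]: "f \<in> borel_measurable borel"
    then have det: "det A \<noteq> 0" "det B \<noteq> 0" by (auto simp: det_mul)
    have "(\<integral>\<^sup>+x. f x \<partial>lborel) = ennreal \<bar>det A\<bar> * (\<integral>\<^sup>+x. f (A *v x) \<partial>lborel)"
      by (rule 1(1)[rule_format, OF det(1)]) simp
    moreover have "(\<integral>\<^sup>+x. f (A *v x) \<partial>lborel) = ennreal \<bar>det B\<bar> * (\<integral>\<^sup>+x. f (A *v (B *v x)) \<partial>lborel)"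
      by (rule 1(2)[rule_format, OF det(2)]) simp
    ultimately show "(\<integral>\<^sup>+x. f x \<partial>lborel) = ennreal \<bar>det (A ** B)\<bar> * (\<integral>\<^sup>+x. f ((A ** B) *v x) \<partial>lborel)"
      by (simp add: det_mul abs_mult ennreal_mult mult.assoc matrix_vector_mul_assoc)
  qed
next
  case (2 A i)
  then show ?case by (simp add: det_zero_row)
next
  case (3 A)
  define c where "c b = b \<bullet> (A *v b)" for b
  have det: "det A = (\<Prod>b\<in>Basis. c b)"
    using 3 by (simp add: det_diagonal prod_Basis_vec c_def inner_axis' matrix_vector_mult_basis column_def)
  \<comment> \<open>The leading \<open>0 +\<close> and the sum over \<open>Basis\<close> reproduce
    the affine map of \<open>lborel_affine_euclidean\<close>, with translation 0.\<close>
  have Av: "A *v x = 0 + (\<Sum>b\<in>Basis. (c b * (x \<bullet> b)) *\<^sub>R b)" for x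
  proof (rule euclidean_eqI)
    fix b :: "real^'k" assume "b \<in> Basis"
    then obtain i where b: "b = axis i 1" by (auto simp: Basis_vec_def)
    have "(A *v x) $ i = A $ i $ i * x $ i"
      unfolding matrix_vector_mult_def using 3
      by (simp add: sum.remove[of UNIV i])
    moreover have "(0 + (\<Sum>b\<in>Basis. (c b * (x \<bullet> b)) *\<^sub>R b)) \<bullet> b = c b * (x \<bullet> b)"
      using \<open>b \<in> Basis\<close> by simp
    ultimately show "(A *v x) \<bullet> b = (0 + (\<Sum>b\<in>Basis. (c b * (x \<bullet> b)) *\<^sub>R b)) \<bullet> b"
      by (simp add: b c_def inner_axis inner_axis' matrix_vector_mult_basis column_def)
  qed
  show ?case
  proof (intro impI ballI)
    fix f :: "real^'k \<Rightarrow> ennreal"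
    assume "det A \<noteq> 0" and [measurable]: "f \<in> borel_measurable borel"
    then have nz: "\<And>b. b \<in> Basis \<Longrightarrow> c b \<noteq> 0" using det by auto
    from lborel_affine_euclidean[of c 0, OF nz]
    have "(\<integral>\<^sup>+x. f x \<partial>lborel) = (\<integral>\<^sup>+x. f x \<partial>density (distr lborel borel ((*v) A)) (\<lambda>_. \<bar>det A\<bar>))"
      unfolding Av[abs_def] det abs_prod by simp
    then show "(\<integral>\<^sup>+x. f x \<partial>lborel) = ennreal \<bar>det A\<bar> * (\<integral>\<^sup>+x. f (A *v x) \<partial>lborel)"
      by (simp add: nn_integral_density nn_integral_distr nn_integral_cmult)
  qed
next
  case (4 m n)
  let ?\<tau> = "Transposition.transpose m n" and ?A = "\<chi> i j. (mat 1 $ i $ Transposition.transpose m n j :: real)"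
  have Av: "?A *v x = (\<chi> i. x $ ?\<tau> i)" for x :: "real^'k"
  proof -
    have "mat 1 $ i $ ?\<tau> j * x $ j = (if j = ?\<tau> i then x $ ?\<tau> i else 0)" for i j
      by (auto simp: mat_def Transposition.transpose_def)
    then show ?thesis by (simp add: matrix_vector_mult_def)
  qed
  have det: "\<bar>det ?A\<bar> = 1"
    using 4 by (simp add: det_permute_columns permutes_swap_id sign_swap_id abs_mult)
  let ?P = "\<Pi>\<^sub>M i\<in>(UNIV::'k set). (lborel :: real measure)"
  \<comment> \<open>A transposition is its own inverse, so the preimage of a product set is the
    product of the same factors in another order, and its measure is unchanged.\<close>
  have P: "distr ?P ?P (\<lambda>x i. x (?\<tau> i)) = ?P"
  proof (rule lborel_prod.PiM_eqI)
    fix X :: "'k \<Rightarrow> real set" assume X: "\<And>i. i \<in> UNIV \<Longrightarrow> X i \<in> sets lborel"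
    have m: "(\<lambda>x i. x (?\<tau> i)) \<in> measurable ?P ?P"
      by (rule measurable_PiM_single') (auto simp: space_PiM)
    have "(\<lambda>x i. x (?\<tau> i)) -` (Pi\<^sub>E UNIV X) \<inter> space ?P = (\<Pi>\<^sub>E i\<in>UNIV. X (?\<tau> i))"
      by (auto simp: PiE_def Pi_def space_PiM) (metis transpose_involutory)+
    then have "emeasure (distr ?P ?P (\<lambda>x i. x (?\<tau> i))) (Pi\<^sub>E UNIV X) = (\<Prod>i\<in>UNIV. emeasure lborel (X (?\<tau> i)))"
      using X m by (subst emeasure_distr) (auto simp: lborel_prod.emeasure_PiM)
    also have "\<dots> = (\<Prod>i\<in>UNIV. emeasure lborel (X i))"
      using prod.permute[OF permutes_swap_id[of m UNIV n], of "\<lambda>i. emeasure lborel (X i)"] by (simp add: o_def)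
    finally show "emeasure (distr ?P ?P (\<lambda>x i. x (?\<tau> i))) (Pi\<^sub>E UNIV X) = (\<Prod>i\<in>UNIV. emeasure lborel (X i))" .
  qed auto
  show ?case
  proof (intro impI ballI)
    fix f :: "real^'k \<Rightarrow> ennreal"
    assume [measurable]: "f \<in> borel_measurable borel"
    have m: "(\<lambda>x i. x (?\<tau> i)) \<in> measurable ?P ?P"
      by (rule measurable_PiM_single') (auto simp: space_PiM)
    have "(\<integral>\<^sup>+x. f x \<partial>lborel) = (\<integral>\<^sup>+x. f (\<chi> i. x i) \<partial>distr ?P ?P (\<lambda>x i. x (?\<tau> i)))"
      by (simp add: P nn_integral_lborel_vec)
    also have "\<dots> = (\<integral>\<^sup>+x. f (\<chi> i. x (?\<tau> i)) \<partial>?P)"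
      using m by (simp add: nn_integral_distr)
    also have "\<dots> = (\<integral>\<^sup>+x. f (?A *v x) \<partial>lborel)"
    proof -
      have "(\<lambda>x. f (?A *v x)) \<in> borel_measurable borel" by measurable
      from nn_integral_lborel_vec[OF this] show ?thesis by (simp only: Av vec_lambda_beta)
    qed
    finally show "(\<integral>\<^sup>+x. f x \<partial>lborel) = ennreal \<bar>det ?A\<bar> * (\<integral>\<^sup>+x. f (?A *v x) \<partial>lborel)"
      by (simp only: det ennreal_1 mult_1)
  qed
next
  case (5 m n c)
  let ?A = "\<chi> i j. (if i = m \<and> j = n then c else of_bool (i = j) :: real)"
  have Av: "?A *v x = (\<chi> i. if i = m then x $ m + c * x $ n else x $ i)" for x :: "real^'k"
  proof -
    have "(\<Sum>j\<in>UNIV. (if i = m \<and> j = n then c else of_bool (i = j)) * x $ j) =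
      (\<Sum>j\<in>UNIV. (if j = i then x $ i else 0) + (if j = n then (if i = m then c * x $ n else 0) else 0))" for i
      using 5 by (intro sum.cong) auto
    then show ?thesis by (simp add: matrix_vector_mult_def sum.distrib vec_eq_iff)
  qed
  have "?A = (\<chi> k. if k = m then row m (mat 1) + c *s row n (mat 1) else row k (mat 1))"
    using 5 by (auto simp: vec_eq_iff row_def mat_def)
  then have det: "det ?A = 1"
    using det_row_operation[OF 5, of "mat 1 :: real^'k^'k" c] by simp
  let ?I = "UNIV - {m}"
  let ?P = "\<lambda>I. \<Pi>\<^sub>M i\<in>(I::'k set). (lborel :: real measure)"
  have U: "insert m ?I = UNIV" by auto
  show ?case
  proof (intro impI ballI)
    fix f :: "real^'k \<Rightarrow> ennreal"
    assume [measurable]: "f \<in> borel_measurable borel"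
    \<comment> \<open>Fubini isolates the coordinate \<open>m\<close>. With the others fixed, the
      shear is the translation of \<open>y\<close> by \<open>c * x n\<close>, which does not depend
      on \<open>y\<close> because \<open>m \<noteq> n\<close>; translation invariance in one
      dimension finishes the case.\<close>
    have split: "(\<integral>\<^sup>+x. g x \<partial>lborel) = (\<integral>\<^sup>+x. \<integral>\<^sup>+y. g (\<chi> i. (x(m := y)) i) \<partial>lborel \<partial>?P ?I)"
      if [measurable]: "g \<in> borel_measurable borel" for g :: "real^'k \<Rightarrow> ennreal"
      using lborel_prod.product_nn_integral_insert[of ?I m "\<lambda>x. g (\<chi> i. x i)"]
      by (simp add: nn_integral_lborel_vec insert_absorb U)
    have "(\<integral>\<^sup>+x. f (?A *v x) \<partial>lborel) = (\<integral>\<^sup>+x. \<integral>\<^sup>+y. f (?A *v (\<chi> i. (x(m := y)) i)) \<partial>lborel \<partial>?P ?I)"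
      by (rule split) simp
    also have "\<dots> = (\<integral>\<^sup>+x. \<integral>\<^sup>+y. f (\<chi> i. (x(m := y)) i) \<partial>lborel \<partial>?P ?I)"
    proof (rule nn_integral_cong)
      fix x :: "'k \<Rightarrow> real"
      have [measurable]: "(\<lambda>y. \<chi> i. (x(m := y)) i) \<in> borel_measurable borel"
        by (subst borel_measurable_euclidean_space) (auto simp: Basis_vec_def inner_axis)
      have "(\<integral>\<^sup>+y. f (\<chi> i. (x(m := y)) i) \<partial>lborel) = (\<integral>\<^sup>+y. f (\<chi> i. (x(m := c * x n + 1 * y)) i) \<partial>lborel)"
        by (subst nn_integral_real_affine[where c=1 and t="c * x n"]) simp_all
      also have "\<dots> = (\<integral>\<^sup>+y. f (?A *v (\<chi> i. (x(m := y)) i)) \<partial>lborel)"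
        unfolding Av using 5 by (intro nn_integral_cong arg_cong[where f=f]) (auto simp: vec_eq_iff)
      finally show "(\<integral>\<^sup>+y. f (?A *v (\<chi> i. (x(m := y)) i)) \<partial>lborel) = (\<integral>\<^sup>+y. f (\<chi> i. (x(m := y)) i) \<partial>lborel)" ..
    qed
    also have "\<dots> = (\<integral>\<^sup>+x. f x \<partial>lborel)"
      by (rule split[symmetric]) simp
    finally show "(\<integral>\<^sup>+x. f x \<partial>lborel) = ennreal \<bar>det ?A\<bar> * (\<integral>\<^sup>+x. f (?A *v x) \<partial>lborel)"
      by (simp only: det abs_one ennreal_1 mult_1)
  qed
qed

section \<open>Factorization of positive definite matrices and the normal law\<close>

text \<open>Gram-Schmidt for the inner product \<open>x \<bullet> (S *v y)\<close>. As long as an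
  index is left over, the vectors \<open>S *v b j\<close> span a proper subspace, so some nonzero
  vector is orthogonal to all of them; dividing it by the square root of its own form value
  normalizes it. The index set \<open>J\<close> is left general to permit the induction.\<close>

lemma pos_def_orthonormal_family:
  fixes S :: "real^'k::finite^'k"
  assumes S: "pos_def_matrix S"
  shows "\<exists>b::'k \<Rightarrow> real^'k. \<forall>i\<in>J. \<forall>j\<in>J. b i \<bullet> (S *v b j) = of_bool (i = j)"
  using finite[of J]
proof (induction J)
  case (insert k J)
  then obtain b :: "'k \<Rightarrow> real^'k" where b: "\<And>i j. i \<in> J \<Longrightarrow> j \<in> J \<Longrightarrow> b i \<bullet> (S *v b j) = of_bool (i = j)"
    by blast
  have sym: "x \<bullet> (S *v y) = y \<bullet> (S *v x)" for x y
    using S by (metis dot_lmul_matrix inner_commute pos_def_matrix_def transpose_matrix_vector)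
  have "dim ((\<lambda>j. S *v b j) ` J) \<le> card J"
    by (meson card_image_le dim_le_card' finite finite_imageI order_trans)
  also have "\<dots> < DIM(real^'k)"
    using insert.hyps by (simp add: psubset_card_mono psubset_eq) (metis UNIV_I psubset_card_mono finite psubsetI subset_UNIV)
  finally obtain x where x: "x \<noteq> 0" "\<And>y. y \<in> span ((\<lambda>j. S *v b j) ` J) \<Longrightarrow> orthogonal x y"
    using orthogonal_to_subspace_exists by blast
  have orth: "x \<bullet> (S *v b j) = 0" if "j \<in> J" for j
    using x(2) that by (simp add: orthogonal_def span_base)
  define q where "q = x \<bullet> (S *v x)"
  have "q > 0" using S x by (simp add: q_def pos_def_matrix_def)
  define z where "z = (1 / sqrt q) *\<^sub>R x"
  have zz: "z \<bullet> (S *v z) = 1"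
    using \<open>q > 0\<close> by (simp add: z_def matrix_vector_mult_scaleR q_def[symmetric] field_simps flip: power2_eq_square)
  have zb: "z \<bullet> (S *v b j) = 0" if "j \<in> J" for j
    using orth[OF that] by (simp add: z_def)
  then have bz: "b j \<bullet> (S *v z) = 0" if "j \<in> J" for j
    using that sym by metis
  show ?case
    using insert.hyps b zz zb bz by (intro exI[of _ "b(k := z)"]) auto
qed simp

text \<open>Let the rows of \<open>B\<close> be a family orthonormal for \<open>S\<close>, so that
  \<open>B ** S ** transpose B\<close> is the identity. The inverse \<open>A\<close> of
  \<open>B\<close> then satisfies A A^T = A (B S B^T) A^T = S.\<close>

lemma pos_def_factor:
  fixes S :: "real^'k::finite^'k"
  assumes S: "pos_def_matrix S"
  obtains A where "S = A ** transpose A" "det A \<noteq> 0"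
proof -
  obtain b :: "'k \<Rightarrow> real^'k" where b: "\<And>i j. b i \<bullet> (S *v b j) = of_bool (i = j)"
    using pos_def_orthonormal_family[OF S, of UNIV] by blast
  define B where "B = (\<chi> i. b i)"
  have BSB: "B ** S ** transpose B = mat 1"
  proof -
    have "(B ** S ** transpose B) $ i $ j = b i \<bullet> (S *v b j)" for i j
      by (simp add: B_def matrix_matrix_mult_def matrix_vector_mult_def inner_vec_def transpose_def
          sum_distrib_left sum_distrib_right mult.assoc) (subst sum.swap, simp)
    then show ?thesis by (simp add: b vec_eq_iff mat_def)
  qed
  then obtain A where A: "A ** B = mat 1"
    by (metis matrix_left_right_inverse matrix_mul_assoc)
  have "A ** transpose A = A ** (B ** S ** transpose B) ** transpose A"
    by (simp add: BSB)
  also have "\<dots> = (A ** B) ** S ** transpose (A ** B)"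
    by (simp add: matrix_mul_assoc matrix_transpose_mul)
  also have "\<dots> = S" by (simp add: A transpose_mat)
  finally have "S = A ** transpose A" ..
  moreover have "det A \<noteq> 0"
    using A by (metis det_I det_mul mult_zero_left zero_neq_one)
  ultimately show ?thesis by (rule that)
qed

lemma mvn_density_std:
  "mvn_density 0 (mat 1) x = (\<Prod>i\<in>UNIV. std_normal_density (x $ i))" for x :: "real^'k::finite"
proof -
  have "matrix_inv (mat 1 :: real^'k^'k) = mat 1"
    by (simp add: matrix_inv_unique)
  then have "mvn_density 0 (mat 1) x = exp (- (x \<bullet> x) / 2) / sqrt (2 * pi) ^ CARD('k)"
    by (simp only: mvn_density_def diff_zero matrix_vector_mul_lid det_I mult_1_right real_sqrt_power)
  also have "exp (- (x \<bullet> x) / 2) = (\<Prod>i\<in>UNIV. exp (- (x $ i)\<^sup>2 / 2))"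
    by (simp add: exp_sum[symmetric] inner_vec_def power2_eq_square sum_negf sum_divide_distrib)
  finally show ?thesis
    by (simp add: std_normal_density_def prod_dividef)
qed

text \<open>The standard density is a product over the coordinates, so both the total mass and the
  Fourier integral factor into one-dimensional integrals.\<close>

lemma
  fixes t :: "real^'k::finite"
  shows charfn_mvn_std: "charfn (mvn 0 (mat 1)) t = of_real (exp (- (t \<bullet> t) / 2))"
    and prob_space_mvn_std: "prob_space (mvn 0 (mat 1 :: real^'k^'k))"
proof -
  let ?P = "\<Pi>\<^sub>M i\<in>(UNIV::'k set). (lborel :: real measure)"
  have [measurable]: "(\<lambda>x::real^'k. \<Prod>i\<in>UNIV. std_normal_density (x $ i)) \<in> borel_measurable borel"
    by measurable
  have nn: "0 \<le> (\<Prod>i\<in>UNIV. std_normal_density (x $ i))" for x :: "real^'k"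
    by (intro prod_nonneg) simp
  have one: "(\<integral>\<^sup>+x. ennreal (std_normal_density x) \<partial>lborel) = 1"
    by (simp add: nn_integral_eq_integral)
  have "(\<integral>\<^sup>+x. ennreal (mvn_density 0 (mat 1) (x :: real^'k)) \<partial>lborel) = (1::ennreal)" (is "?I = _")
  proof -
    have "?I = (\<integral>\<^sup>+x. (\<Prod>i\<in>UNIV. ennreal (std_normal_density (x i))) \<partial>?P)"
      by (subst nn_integral_lborel_vec) (auto simp: mvn_density_std prod_ennreal[symmetric])
    also have "\<dots> = 1"
      by (subst lborel_prod.product_nn_integral_prod) (auto simp: one)
    finally show ?thesis .
  qed
  then show "prob_space (mvn 0 (mat 1 :: real^'k^'k))"
    by (intro prob_spaceI) (simp add: mvn_def emeasure_density mvn_density_std)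
  have "charfn (mvn 0 (mat 1)) t =
      (CLINT x|lborel. (\<Prod>i\<in>UNIV. std_normal_density (x $ i) *\<^sub>R iexp (t $ i * x $ i)))"
    unfolding charfn_def mvn_def mvn_density_std
    by (subst integral_density)
       (auto simp: nn inner_vec_def sum_distrib_left exp_sum prod.distrib scaleR_conv_of_real)
  also have "\<dots> = (CLINT x|?P. (\<Prod>i\<in>UNIV. std_normal_density (x i) *\<^sub>R iexp (t $ i * x i)))"
    by (subst lborel_vec_eq, subst integral_distr) auto
  also have "\<dots> = (\<Prod>i\<in>UNIV. CLINT x|lborel. std_normal_density x *\<^sub>R iexp (t $ i * x))"
    by (rule lborel_prod.product_integral_prod)
       (auto intro!: Bochner_Integration.integrable_bound[OF integrable_normal_density[of 1 0]])
  also have "\<dots> = (\<Prod>i\<in>UNIV. char std_normal_distribution (t $ i))"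
    unfolding char_def by (intro prod.cong refl, subst integral_density) auto
  also have "\<dots> = of_real (exp (- (t \<bullet> t) / 2))"
    by (simp add: char_std_normal_distribution inner_vec_def exp_sum[symmetric] power2_eq_square sum_negf sum_divide_distrib
        flip: of_real_prod)
  finally show "charfn (mvn 0 (mat 1)) t = of_real (exp (- (t \<bullet> t) / 2))" .
qed

lemma borel_measurable_mvn_density [measurable]: "mvn_density \<mu> S \<in> borel_measurable borel"
  for \<mu> :: "real^'k::finite"
  unfolding mvn_density_def[abs_def] by measurable

text \<open>Substituting \<open>\<mu> + A *v x\<close> turns the quadratic form of S^-1 into
  \<open>x \<bullet> x\<close>, and the Jacobian \<open>\<bar>det A\<bar>\<close> cancels against
  the square root of \<open>det S = (det A)^2\<close> in the normalizing constant.\<close>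

lemma mvn_eq_distr_std:
  fixes A :: "real^'k::finite^'k"
  assumes S: "S = A ** transpose A" and A: "det A \<noteq> 0"
  shows "mvn \<mu> S = distr (mvn 0 (mat 1)) borel (\<lambda>x. \<mu> + A *v x)"
proof (rule measure_eqI)
  obtain B where BA: "B ** A = mat 1" and AB: "A ** B = mat 1"
    using A by (metis invertible_det_nz invertible_def)
  have tBA: "transpose A ** transpose B = mat 1"
    by (metis BA matrix_transpose_mul transpose_mat)
  have "S ** (transpose B ** B) = A ** (transpose A ** transpose B) ** B"
    by (simp add: S matrix_mul_assoc)
  then have SB: "S ** (transpose B ** B) = mat 1" by (simp add: tBA AB)
  then have inv: "matrix_inv S = transpose B ** B"
    by (rule matrix_inv_unique)
  have dens: "ennreal \<bar>det A\<bar> * ennreal (mvn_density \<mu> S (\<mu> + A *v x)) = ennreal (mvn_density 0 (mat 1) x)" for x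
  proof -
    have "(A *v x) \<bullet> ((transpose B ** B) *v (A *v x)) = x \<bullet> x"
    proof -
      have BAx: "B *v (A *v x) = x" by (simp add: matrix_vector_mul_assoc BA)
      then have "(transpose B ** B) *v (A *v x) = transpose B *v x"
        by (simp only: matrix_vector_mul_assoc[symmetric])
      then show ?thesis
        by (simp only: inner_commute[of "A *v x"] inner_transpose_matrix BAx)
    qed
    moreover have "matrix_inv (mat 1 :: real^'k^'k) = mat 1"
      by (simp add: matrix_inv_unique)
    moreover have "sqrt ((2 * pi) ^ CARD('k) * det S) = \<bar>det A\<bar> * sqrt ((2 * pi) ^ CARD('k))"
      by (simp add: S det_mul det_transpose real_sqrt_mult)
    ultimately have "\<bar>det A\<bar> * mvn_density \<mu> S (\<mu> + A *v x) = mvn_density 0 (mat 1) x"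
      using A by (simp add: mvn_density_def inv)
    then show ?thesis by (simp add: ennreal_mult'[symmetric])
  qed
  fix X assume "X \<in> sets (mvn \<mu> S)"
  then have [measurable]: "X \<in> sets borel" by (simp add: mvn_def)
  have "emeasure (mvn \<mu> S) X = (\<integral>\<^sup>+x. ennreal (mvn_density \<mu> S x) * indicator X x \<partial>lborel)"
    by (simp add: mvn_def emeasure_density)
  also have "\<dots> = (\<integral>\<^sup>+x. ennreal (mvn_density \<mu> S (\<mu> + x)) * indicator X (\<mu> + x) \<partial>lborel)"
    by (subst lborel_distr_plus[of \<mu>, symmetric], subst nn_integral_distr) auto
  also have "\<dots> = ennreal \<bar>det A\<bar> * (\<integral>\<^sup>+x. ennreal (mvn_density \<mu> S (\<mu> + A *v x)) * indicator X (\<mu> + A *v x) \<partial>lborel)"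
    by (rule nn_integral_lborel_linear[rule_format, OF A]) simp
  also have "\<dots> = (\<integral>\<^sup>+x. ennreal (mvn_density 0 (mat 1) x) * indicator X (\<mu> + A *v x) \<partial>lborel)"
    by (subst nn_integral_cmult[symmetric]) (auto simp: mult.assoc[symmetric] dens)
  also have "\<dots> = emeasure (distr (mvn 0 (mat 1)) borel (\<lambda>x. \<mu> + A *v x)) X"
    using measurable_sets_borel[of "\<lambda>x. \<mu> + A *v x" borel X]
    by (subst emeasure_distr)
       (auto simp: mvn_def emeasure_density indicator_def intro!: nn_integral_cong)
  finally show "emeasure (mvn \<mu> S) X = emeasure (distr (mvn 0 (mat 1)) borel (\<lambda>x. \<mu> + A *v x)) X" .
qed (simp add: mvn_def)

lemma prob_space_mvn:
  assumes "pos_def_matrix S"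
  shows "prob_space (mvn \<mu> S)"
proof -
  obtain A where "S = A ** transpose A" "det A \<noteq> 0"
    using assms by (rule pos_def_factor)
  then show ?thesis
    by (simp add: mvn_eq_distr_std) (rule prob_space.prob_space_distr[OF prob_space_mvn_std], simp add: mvn_def)
qed

text \<open>The affine representation moves \<open>A\<close> to the frequency, as t \<bullet> A x =
  (A^T t) \<bullet> x, and the squared length of A^T t is
  \<open>t \<bullet> (S *v t)\<close>.\<close>

lemma charfn_mvn:
  assumes "pos_def_matrix S"
  shows "charfn (mvn \<mu> S) t = exp (\<i> * of_real (t \<bullet> \<mu>) - of_real (t \<bullet> (S *v t)) / 2)"
proof -
  obtain A where S: "S = A ** transpose A" and A: "det A \<noteq> 0"
    using assms by (rule pos_def_factor)
  have "charfn (mvn \<mu> S) t = (CLINT x|mvn 0 (mat 1). iexp (t \<bullet> (\<mu> + A *v x)))"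
    unfolding charfn_def mvn_eq_distr_std[OF S A] by (subst integral_distr) (auto simp: mvn_def)
  also have "\<dots> = (CLINT x|mvn 0 (mat 1). iexp (t \<bullet> \<mu>) * iexp ((transpose A *v t) \<bullet> x))"
    by (simp only: inner_add_right inner_transpose_matrix of_real_add distrib_left exp_add)
  also have "\<dots> = iexp (t \<bullet> \<mu>) * charfn (mvn 0 (mat 1)) (transpose A *v t)"
    by (simp add: charfn_def)
  also have "charfn (mvn 0 (mat 1)) (transpose A *v t) = exp (of_real (- (t \<bullet> (S *v t)) / 2))"
    by (simp only: charfn_mvn_std inner_transpose_matrix matrix_vector_mul_assoc S[symmetric] exp_of_real)
  also have "iexp (t \<bullet> \<mu>) * exp (of_real (- (t \<bullet> (S *v t)) / 2)) =
      exp (\<i> * of_real (t \<bullet> \<mu>) - of_real (t \<bullet> (S *v t)) / 2)"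
    by (simp add: exp_add[symmetric])
  finally show ?thesis .
qed

section \<open>Normal laws, densities and products\<close>

text \<open>Parametrized by the variance, with a Dirac measure at variance 0, so that moments and
  characteristic function obey one formula for all \<open>v \<ge> 0\<close>. The degenerate case
  does arise: the residual of a combination of observations has variance 0.\<close>

definition normal_law :: "real \<Rightarrow> real \<Rightarrow> real measure" where
  "normal_law a v = (if v = 0 then return borel a else density lborel (normal_density a (sqrt v)))"

lemma real_gaussian_iff_normal_law: "real_gaussian N \<longleftrightarrow> (\<exists>a v. 0 \<le> v \<and> N = normal_law a v)"
proof
  assume "real_gaussian N"
  then consider a s where "s > 0" "N = density lborel (\<lambda>x. ennreal (normal_density a s x))"
    | a where "N = return borel a"
    by (auto simp: real_gaussian_def)
  then show "\<exists>a v. 0 \<le> v \<and> N = normal_law a v"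
  proof cases
    case (1 a s)
    then have "N = normal_law a (s\<^sup>2)" by (simp add: normal_law_def)
    then show ?thesis by (metis zero_le_power2)
  next
    case (2 a)
    then have "N = normal_law a 0" by (simp add: normal_law_def)
    then show ?thesis by blast
  qed
next
  assume "\<exists>a v. 0 \<le> v \<and> N = normal_law a v"
  then show "real_gaussian N"
    unfolding real_gaussian_def normal_law_def
    by (metis less_eq_real_def real_sqrt_gt_0_iff)
qed

text \<open>Reduces the characteristic function of a nondegenerate \<open>normal_law\<close> to that
  of the standard normal law.\<close>

lemma normal_density_eq_distr_std:
  assumes "s > 0"
  shows "density lborel (normal_density a s) = distr std_normal_distribution borel (\<lambda>x. a + s * x)"
proof -
  interpret prob_space std_normal_distribution by (rule prob_space_normal_density) simp
  have "distributed std_normal_distribution lborel (\<lambda>x. x) std_normal_density"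
    by (simp add: distributed_def distr_id2)
  from normal_density_affine[OF this, of s a]
  have "distributed std_normal_distribution lborel (\<lambda>x. a + s * x) (normal_density a s)"
    using assms by simp
  then show ?thesis
    by (simp add: distributed_def cong: distr_cong)
qed

lemma
  assumes "0 \<le> v"
  shows real_distribution_normal_law: "real_distribution (normal_law a v)"
    and integrable_normal_law: "integrable (normal_law a v) (\<lambda>x. x)"
    and integral_normal_law: "(\<integral>x. x \<partial>normal_law a v) = a"
    and integrable_normal_law_square: "integrable (normal_law a v) (\<lambda>x. (x - a)\<^sup>2)"
    and variance_normal_law: "(\<integral>x. (x - a)\<^sup>2 \<partial>normal_law a v) = v"
    and char_normal_law: "char (normal_law a v) t = exp (\<i> * of_real (t * a) - of_real (t\<^sup>2 * v) / 2)"
proof -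
  have "real_distribution (normal_law a v) \<and> integrable (normal_law a v) (\<lambda>x. x) \<and>
    (\<integral>x. x \<partial>normal_law a v) = a \<and> integrable (normal_law a v) (\<lambda>x. (x - a)\<^sup>2) \<and>
    (\<integral>x. (x - a)\<^sup>2 \<partial>normal_law a v) = v \<and>
    char (normal_law a v) t = exp (\<i> * of_real (t * a) - of_real (t\<^sup>2 * v) / 2)"
  proof (cases "v = 0")
    case True
    interpret R: prob_space "return borel a" by (rule prob_space_return) simp
    have int: "integrable (return borel a) f" if [measurable]: "f \<in> borel_measurable borel" for f :: "real \<Rightarrow> real"
      by (rule R.integrable_const_bound[of _ "norm (f a)"]) (auto simp: AE_return)
    have "integrable (return borel a) (\<lambda>x. x)" "integrable (return borel a) (\<lambda>x. (x - a)\<^sup>2)"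
      by (rule int; measurable)+
    moreover have "real_distribution (return borel a)"
      using R.prob_space_axioms by (simp add: real_distribution_def real_distribution_axioms_def)
    moreover have "char (return borel a) t = iexp (t * a)"
      by (simp add: char_def integral_return)
    moreover have "(\<integral>x. x \<partial>return borel a) = a" "(\<integral>x. (x - a)\<^sup>2 \<partial>return borel a) = 0"
      by (simp_all add: integral_return)
    ultimately show ?thesis
      using True by (simp add: normal_law_def)
  next
    case False
    then have s: "sqrt v > 0" using assms by simp
    have N: "normal_law a v = density lborel (normal_density a (sqrt v))"
      using False by (simp add: normal_law_def)
    have "real_distribution (normal_law a v)"
      using s prob_space_normal_density[OF s, of a]
      by (simp add: N real_distribution_def real_distribution_axioms_def)
    moreover have "char (normal_law a v) t = exp (\<i> * of_real (t * a) - of_real (t\<^sup>2 * v) / 2)"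
    proof -
      have "char (normal_law a v) t = (CLINT x|std_normal_distribution. iexp (t * a) * iexp ((t * sqrt v) * x))"
        unfolding char_def N normal_density_eq_distr_std[OF s]
        by (subst integral_distr) (auto simp: algebra_simps exp_add)
      also have "\<dots> = iexp (t * a) * char std_normal_distribution (t * sqrt v)"
        by (simp add: char_def)
      also have "\<dots> = exp (\<i> * of_real (t * a) - of_real (t\<^sup>2 * v) / 2)"
        using assms by (simp add: char_std_normal_distribution power_mult_distrib exp_add[symmetric] flip: exp_of_real of_real_power)
      finally show ?thesis .
    qed
    \<comment> \<open>The arguments \<open>2\<close> and \<open>1\<close> select the same moment, of
      order 2 = 2 * 1: the second central moment is the square of \<open>sqrt v\<close>, that is
      \<open>v\<close>.\<close>
    ultimately show ?thesis
      using integrable_normal_moment_nz_1[OF s, of a] integral_normal_moment_nz_1[OF s, of a]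
        integrable_normal_moment[OF s, of a 2] integral_normal_moment_even[OF s, of a 1] assms
      by (simp add: N integrable_density integral_density mult.commute)
  qed
  then show "real_distribution (normal_law a v)" "integrable (normal_law a v) (\<lambda>x. x)"
    "(\<integral>x. x \<partial>normal_law a v) = a" "integrable (normal_law a v) (\<lambda>x. (x - a)\<^sup>2)"
    "(\<integral>x. (x - a)\<^sup>2 \<partial>normal_law a v) = v"
    "char (normal_law a v) t = exp (\<i> * of_real (t * a) - of_real (t\<^sup>2 * v) / 2)"
    by blast+
qed

lemma normal_law_eqI_char:
  assumes "prob_space N" "sets N = sets borel" "0 \<le> v"
    and "\<And>t. char N t = exp (\<i> * of_real (t * a) - of_real (t\<^sup>2 * v) / 2)"
  shows "N = normal_law a v"
proof (rule Levy_uniqueness)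
  show "real_distribution N"
    using assms by (simp add: real_distribution_def real_distribution_axioms_def)
qed (use assms in \<open>auto simp: real_distribution_normal_law char_normal_law\<close>)

section \<open>Positive definiteness and quotients of normal densities\<close>

text \<open>If the form vanished at some \<open>x \<noteq> 0\<close>, then \<open>y = S *v x\<close>
  would be nonzero by invertibility. Moving from \<open>x\<close> by \<open>s *\<^sub>R y\<close>
  changes the form by 2 s |y|^2 + s^2 (y \<bullet> S y), which is negative for small negative
  \<open>s\<close>.\<close>

lemma pos_def_matrixI:
  fixes S :: "real^'k::finite^'k"
  assumes sym: "transpose S = S" and nonneg: "\<And>x. 0 \<le> x \<bullet> (S *v x)" and inv: "invertible S"
  shows "pos_def_matrix S"
  unfolding pos_def_matrix_def
proof (intro conjI allI impI)
  fix x :: "real^'k" assume "x \<noteq> 0"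
  define y where "y = S *v x"
  have sy: "x \<bullet> (S *v y) = y \<bullet> y"
    using sym by (metis inner_commute inner_transpose_matrix y_def)
  have "y \<noteq> 0"
    using inv \<open>x \<noteq> 0\<close> unfolding y_def
    by (metis invertible_def matrix_vector_mul_assoc matrix_vector_mul_lid matrix_vector_mult_0_right)
  show "0 < x \<bullet> (S *v x)"
  proof (rule ccontr)
    assume "\<not> 0 < x \<bullet> (S *v x)"
    then have z: "x \<bullet> (S *v x) = 0" using nonneg[of x] by simp
    have q: "0 \<le> s * (2 * (y \<bullet> y) + s * (y \<bullet> (S *v y)))" for s
    proof -
      have "(x + s *\<^sub>R y) \<bullet> (S *v (x + s *\<^sub>R y)) = s * (2 * (y \<bullet> y) + s * (y \<bullet> (S *v y)))"
        using z sy by (simp add: matrix_vector_right_distrib matrix_vector_mult_scaleR inner_add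
            algebra_simps flip: y_def)
      then show ?thesis using nonneg[of "x + s *\<^sub>R y"] by simp
    qed
    \<comment> \<open>The displacement used is s = - |y|^2 / (c + 1). The added 1 avoids division by
      zero when \<open>c = 0\<close>, and |s| c \<le> |y|^2 keeps the bracket in \<open>q\<close>
      positive.\<close>
    define c where "c = y \<bullet> (S *v y)"
    have "y \<bullet> y > 0" using \<open>y \<noteq> 0\<close> by simp
    moreover have "c \<ge> 0" using nonneg by (simp add: c_def)
    ultimately have "(y \<bullet> y) / (c + 1) * c \<le> y \<bullet> y"
      by (simp add: field_simps)
    then have "2 * (y \<bullet> y) + - ((y \<bullet> y) / (c + 1)) * c > 0"
      using \<open>y \<bullet> y > 0\<close> by linarith
    moreover have "(y \<bullet> y) / (c + 1) > 0" using \<open>y \<bullet> y > 0\<close> \<open>c \<ge> 0\<close> by simp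
    ultimately show False
      using q[of "- ((y \<bullet> y) / (c + 1))"] unfolding c_def[symmetric]
      by (meson mult_neg_pos neg_less_0_iff_less not_less)
  qed
qed (rule sym)

lemma mvn_density_pos:
  fixes S :: "real^'k::finite^'k"
  assumes "pos_def_matrix S"
  shows "0 < mvn_density \<mu> S x"
proof -
  obtain A where "S = A ** transpose A" "det A \<noteq> 0"
    using assms by (rule pos_def_factor)
  then have "det S > 0"
    by (simp add: det_mul det_transpose) (metis not_real_square_gt_zero)
  then show ?thesis by (simp add: mvn_density_def)
qed

text \<open>The Lebesgue density of the reference law vanishes nowhere, so the quotient of the two
  densities is a density of one normal law with respect to the other.\<close>

lemma mvn_eq_density_mvn:
  fixes S T :: "real^'k::finite^'k"
  assumes "pos_def_matrix S"
  shows "mvn \<mu> T = density (mvn \<nu> S) (\<lambda>u. ennreal (mvn_density \<mu> T u / mvn_density \<nu> S u))"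
proof -
  have "ennreal (mvn_density \<nu> S u) * ennreal (mvn_density \<mu> T u / mvn_density \<nu> S u) = ennreal (mvn_density \<mu> T u)" for u
    using mvn_density_pos[OF assms, of \<nu> u] by (simp add: ennreal_mult'[symmetric])
  then show ?thesis
    by (simp add: mvn_def density_density_eq)
qed

lemma charfn_pair_measure:
  fixes N1 :: "'a::euclidean_space measure" and N2 :: "'b::euclidean_space measure"
  assumes "finite_measure N1" "finite_measure N2" and sets: "sets N1 = sets borel" "sets N2 = sets borel"
  shows "charfn (N1 \<Otimes>\<^sub>M N2) t = charfn N1 (fst t) * charfn N2 (snd t)"
proof -
  interpret N1: finite_measure N1 by fact
  interpret N2: finite_measure N2 by fact
  interpret pair_sigma_finite N1 N2 ..
  interpret N12: finite_measure "N1 \<Otimes>\<^sub>M N2"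
    by (rule finite_measure_pair_measure) fact+
  have [measurable_cong]: "sets N1 = sets borel" "sets N2 = sets borel" by fact+
  have "charfn (N1 \<Otimes>\<^sub>M N2) t = (CLINT z|N1 \<Otimes>\<^sub>M N2. iexp (fst t \<bullet> fst z) * iexp (snd t \<bullet> snd z))"
    unfolding charfn_def by (intro Bochner_Integration.integral_cong refl)
      (simp add: inner_prod_def exp_add[symmetric] algebra_simps)
  also have "\<dots> = (CLINT x|N1. CLINT y|N2. iexp (fst t \<bullet> x) * iexp (snd t \<bullet> y))"
    by (subst integral_fst'[symmetric]) (auto intro!: N12.integrable_const_bound[of _ 1] simp: norm_mult)
  also have "\<dots> = charfn N1 (fst t) * charfn N2 (snd t)"
    by (simp add: charfn_def)
  finally show ?thesis .
qed

lemma borel_measurable_blinfun_apply [measurable]: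
  "blinfun_apply x \<in> borel_measurable borel"
  by (intro borel_measurable_continuous_onI continuous_intros)

section \<open>Reweighting a Gaussian random element\<close>

locale gaussian_element =
  fixes M :: "'a measure"
    and F :: "'a \<Rightarrow> 'e::{banach, second_countable_topology}"
    and m :: 'e
    and C :: "('e \<Rightarrow>\<^sub>L real) \<Rightarrow> 'e"
  assumes gauss: "gaussian_random_element M F"
    and mean: "is_mean_re M F m"
    and cov: "is_cov_re M F m C"
begin

sublocale prob_space M
  using gauss by (simp add: gaussian_random_element_def)

lemma measurable_F [measurable]: "F \<in> borel_measurable M"
  using gauss by (simp add: gaussian_random_element_def)

text \<open>\<open>C\<close> is just a map, with no linearity assumed. Symmetry carries sums and
  multiples from the argument of \<open>C\<close> to the functional being applied, where they can be
  expanded; later covariance computations rely on this.\<close>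

lemma cov_sym: "blinfun_apply y (C x) = blinfun_apply x (C y)"
  using cov by (simp add: is_cov_re_def mult.commute)

text \<open>Gaussianity only provides some parameters \<open>a\<close> and \<open>v\<close>;
  computing the first moment and the second central moment identifies them with the values given by
  \<open>m\<close> and \<open>C\<close>.\<close>

lemma distr_functional:
  shows var_nonneg: "0 \<le> blinfun_apply T (C T)"
    and "distr M borel (\<lambda>\<omega>. blinfun_apply T (F \<omega>)) = normal_law (blinfun_apply T m) (blinfun_apply T (C T))"
proof -
  let ?N = "distr M borel (\<lambda>\<omega>. blinfun_apply T (F \<omega>))"
  obtain a v where v: "0 \<le> v" and N: "?N = normal_law a v"
    using gauss[unfolded gaussian_random_element_def real_gaussian_iff_normal_law] by blast
  have "blinfun_apply T m = (\<integral>\<omega>. blinfun_apply T (F \<omega>) \<partial>M)"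
    using mean by (simp add: is_mean_re_def)
  also have "\<dots> = (\<integral>x. x \<partial>?N)" by (simp add: integral_distr)
  finally have a: "blinfun_apply T m = a" using v by (simp add: N integral_normal_law)
  have "blinfun_apply T (C T) = (\<integral>\<omega>. (blinfun_apply T (F \<omega>) - a)\<^sup>2 \<partial>M)"
    using cov by (simp add: is_cov_re_def a power2_eq_square)
  also have "\<dots> = (\<integral>x. (x - a)\<^sup>2 \<partial>?N)" by (simp add: integral_distr)
  finally have "blinfun_apply T (C T) = v" using v by (simp add: N variance_normal_law)
  with v N a show "0 \<le> blinfun_apply T (C T)"
    "?N = normal_law (blinfun_apply T m) (blinfun_apply T (C T))"
    by simp_all
qed

text \<open>Frequency 1 is enough, since multiples and sums of functionals are functionals as well:
  applied to linear combinations, this formula yields joint characteristic functions.\<close>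

lemma char_functional:
  "(CLINT \<omega>|M. iexp (blinfun_apply T (F \<omega>))) =
    exp (\<i> * of_real (blinfun_apply T m) - of_real (blinfun_apply T (C T)) / 2)"
proof -
  have "(CLINT \<omega>|M. iexp (blinfun_apply T (F \<omega>))) = char (distr M borel (\<lambda>\<omega>. blinfun_apply T (F \<omega>))) 1"
    unfolding char_def by (subst integral_distr) auto
  then show ?thesis
    using char_normal_law[OF var_nonneg[of T], of "blinfun_apply T m" 1] by (simp add: distr_functional(2))
qed

end

section \<open>Observations, regression coefficients and residuals\<close>

locale observed_gaussian = gaussian_element M F m C
  for M :: "'a measure" and F :: "'a \<Rightarrow> 'e::{banach, second_countable_topology}" and m C +
  fixes L :: "'k::finite \<Rightarrow> ('e \<Rightarrow>\<^sub>L real)"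
  assumes invertible_cov: "invertible (\<chi> i j. blinfun_apply (L j) (C (L i)))"
begin

definition obs :: "'e \<Rightarrow> real^'k" where
  "obs f = (\<chi> j. blinfun_apply (L j) f)"

text \<open>The adjoint of \<open>obs\<close>. It turns a frequency in the observation space into a
  single functional, to which the one-dimensional results apply.\<close>

definition comb :: "real^'k \<Rightarrow> ('e \<Rightarrow>\<^sub>L real)" where
  "comb t = (\<Sum>j\<in>UNIV. t $ j *\<^sub>R L j)"

definition obs_cov :: "real^'k^'k" where
  "obs_cov = (\<chi> i j. blinfun_apply (L j) (C (L i)))"

lemma comb_apply: "blinfun_apply (comb t) f = t \<bullet> obs f"
  by (simp add: comb_def obs_def inner_vec_def blinfun.sum_left blinfun.scaleR_left)

lemma measurable_obs [measurable]: "obs \<in> borel_measurable borel"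
  unfolding obs_def[abs_def]
  by (subst borel_measurable_euclidean_space) (auto simp: Basis_vec_def inner_axis)

lemma cov_comb: "blinfun_apply T (C (comb t)) = t \<bullet> obs (C T)"
  by (simp add: cov_sym[of T] comb_apply)

lemma obs_C_comb: "obs (C (comb t)) = obs_cov *v t"
  by (simp add: vec_eq_iff obs_def[of "C (comb t)"] cov_comb)
     (simp add: inner_vec_def matrix_vector_mult_def obs_cov_def obs_def mult.commute)

lemma transpose_obs_cov: "transpose obs_cov = obs_cov"
  by (simp add: transpose_def obs_cov_def vec_eq_iff) (metis cov_sym)

text \<open>The quadratic form at \<open>t\<close> is the variance of the functional
  \<open>comb t\<close>, hence nonnegative; invertibility upgrades this to definiteness.\<close>

lemma pos_def_obs_cov: "pos_def_matrix obs_cov"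
proof (rule pos_def_matrixI)
  show "0 \<le> t \<bullet> (obs_cov *v t)" for t
    using var_nonneg[of "comb t"] by (simp add: comb_apply obs_C_comb)
qed (use invertible_cov in \<open>simp_all add: transpose_obs_cov obs_cov_def[symmetric]\<close>)

text \<open>The Cramer-Wold argument: the characteristic function at \<open>t\<close> is the
  expectation of exp(i X) with X = \<open>comb t\<close> applied to F, and this X is
  Gaussian.\<close>

lemma distr_obs: "distr M borel (\<lambda>\<omega>. obs (F \<omega>)) = mvn (obs m) obs_cov"
proof (rule finite_measure_eqI_charfn)
  show "finite_measure (distr M borel (\<lambda>\<omega>. obs (F \<omega>)))"
    by (rule finite_measure_distr) simp
  show "finite_measure (mvn (obs m) obs_cov)"
    using prob_space_mvn[OF pos_def_obs_cov] by (rule prob_space.finite_measure)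
  fix t
  have "charfn (distr M borel (\<lambda>\<omega>. obs (F \<omega>))) t = (CLINT \<omega>|M. iexp (blinfun_apply (comb t) (F \<omega>)))"
    unfolding charfn_def by (subst integral_distr) (auto simp: comb_apply)
  also have "\<dots> = charfn (mvn (obs m) obs_cov) t"
    unfolding char_functional charfn_mvn[OF pos_def_obs_cov] by (simp add: comb_apply obs_C_comb)
  finally show "charfn (distr M borel (\<lambda>\<omega>. obs (F \<omega>))) t = charfn (mvn (obs m) obs_cov) t" .
qed (simp_all add: mvn_def)

text \<open>The coefficients of the linear regression of T(F) on L(F); \<open>obs (C T)\<close> is
  the column C_LT. In filtering theory this is the Kalman gain.\<close>

definition gain :: "('e \<Rightarrow>\<^sub>L real) \<Rightarrow> real^'k" where
  "gain T = matrix_inv obs_cov *v obs (C T)"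

definition resid :: "('e \<Rightarrow>\<^sub>L real) \<Rightarrow> ('e \<Rightarrow>\<^sub>L real)" where
  "resid T = T - comb (gain T)"

lemma obs_cov_inv: "obs_cov ** matrix_inv obs_cov = mat 1"
  using invertible_cov by (metis invertible_def matrix_inv_unique obs_cov_def)

lemma transpose_inv_obs_cov: "transpose (matrix_inv obs_cov) = matrix_inv obs_cov"
proof -
  have "transpose (matrix_inv obs_cov) ** obs_cov = mat 1"
    using arg_cong[OF obs_cov_inv, of transpose]
    by (simp add: matrix_transpose_mul transpose_obs_cov transpose_mat)
  then show ?thesis
    by (metis matrix_inv_unique matrix_left_right_inverse)
qed

lemma obs_cov_gain: "obs_cov *v gain T = obs (C T)"
  by (simp add: gain_def matrix_vector_mul_assoc obs_cov_inv)

lemma resid_apply: "blinfun_apply (resid T) f = blinfun_apply T f - gain T \<bullet> obs f"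
  by (simp add: resid_def blinfun.diff_left comb_apply)

text \<open>These are the normal equations \<open>obs_cov_gain\<close>, transported by the symmetry
  of \<open>obs_cov\<close>. They remove the cross term in the joint characteristic function of
  residual and observations.\<close>

lemma cov_resid_comb: "blinfun_apply (resid T) (C (comb t)) = 0"
proof -
  have "gain T \<bullet> (obs_cov *v t) = t \<bullet> obs (C T)"
    by (metis inner_commute inner_transpose_matrix obs_cov_gain transpose_obs_cov)
  moreover have "blinfun_apply (resid T) (C (comb t)) = blinfun_apply T (C (comb t)) - gain T \<bullet> obs (C (comb t))"
    by (rule resid_apply)
  ultimately show ?thesis by (simp only: cov_comb obs_C_comb)
qed

text \<open>The residual is uncorrelated with \<open>comb (gain T)\<close>, so its variance equals
  its covariance with \<open>T\<close>. The result is the Schur complement of C_LL.\<close>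

lemma var_resid: "blinfun_apply (resid T) (C (resid T)) = blinfun_apply T (C T) - gain T \<bullet> obs (C T)"
proof -
  have "blinfun_apply (resid T) (C (resid T)) = blinfun_apply T (C (resid T)) - blinfun_apply (comb (gain T)) (C (resid T))"
    by (simp add: resid_def blinfun.diff_left)
  also have "\<dots> = blinfun_apply (resid T) (C T)"
    by (simp add: cov_sym[of _ "resid T"] cov_resid_comb)
  finally show ?thesis by (simp add: resid_apply)
qed

abbreviation resid_law :: "('e \<Rightarrow>\<^sub>L real) \<Rightarrow> real measure" where
  "resid_law T \<equiv> normal_law (blinfun_apply (resid T) m) (blinfun_apply (resid T) (C (resid T)))"

lemma prob_space_resid_law: "prob_space (resid_law T)" and sets_resid_law: "sets (resid_law T) = sets borel"
  using real_distribution_normal_law[OF var_nonneg, of "blinfun_apply (resid T) m" "resid T"]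
  by (auto simp: real_distribution_def real_distribution_axioms_def)

text \<open>At \<open>(s, t)\<close> the characteristic function of the pair is that of the
  functional \<open>?T\<close> at 1. The variance of \<open>?T\<close> has no cross term, so the
  exponential splits into the two marginal factors.\<close>

lemma distr_resid_obs:
  "distr M borel (\<lambda>\<omega>. (blinfun_apply (resid T) (F \<omega>), obs (F \<omega>))) = resid_law T \<Otimes>\<^sub>M mvn (obs m) obs_cov"
proof (rule finite_measure_eqI_charfn)
  note fin = prob_space.finite_measure[OF prob_space_resid_law[of T]]
    prob_space.finite_measure[OF prob_space_mvn[OF pos_def_obs_cov, of "obs m"]]
  show "finite_measure (distr M borel (\<lambda>\<omega>. (blinfun_apply (resid T) (F \<omega>), obs (F \<omega>))))"
    by (rule finite_measure_distr) simp
  show "finite_measure (resid_law T \<Otimes>\<^sub>M mvn (obs m) obs_cov)"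
    by (rule finite_measure_pair_measure) fact+
  have s: "sets (mvn (obs m) obs_cov) = sets borel" by (simp add: mvn_def)
  show "sets (resid_law T \<Otimes>\<^sub>M mvn (obs m) obs_cov) = sets borel"
    by (simp add: borel_prod[symmetric] sets_resid_law s cong: sets_pair_measure_cong)
  fix z :: "real \<times> (real^'k)"
  obtain s t where z: "z = (s, t)" by fastforce
  let ?T = "s *\<^sub>R resid T + comb t"
  let ?v = "blinfun_apply (resid T) (C (resid T))"
  have "charfn (distr M borel (\<lambda>\<omega>. (blinfun_apply (resid T) (F \<omega>), obs (F \<omega>)))) z =
      (CLINT \<omega>|M. iexp (blinfun_apply ?T (F \<omega>)))"
    unfolding charfn_def
    by (subst integral_distr) (auto simp: z comb_apply blinfun.add_left blinfun.scaleR_left)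
  also have "\<dots> = exp (\<i> * of_real (blinfun_apply ?T m) - of_real (blinfun_apply ?T (C ?T)) / 2)"
    by (rule char_functional)
  also have "blinfun_apply ?T (C ?T) = s\<^sup>2 * ?v + t \<bullet> (obs_cov *v t)"
  proof -
    have "blinfun_apply (resid T) (C ?T) = s * ?v"
      by (subst cov_sym) (simp add: blinfun.add_left blinfun.scaleR_left cov_sym[of "comb t"] cov_resid_comb)
    moreover have "blinfun_apply (comb t) (C ?T) = t \<bullet> (obs_cov *v t)"
      by (subst cov_sym) (simp add: blinfun.add_left blinfun.scaleR_left cov_resid_comb, simp add: comb_apply obs_C_comb)
    ultimately show ?thesis
      by (simp add: blinfun.add_left blinfun.scaleR_left power2_eq_square)
  qed
  also have "exp (\<i> * of_real (blinfun_apply ?T m) - of_real (s\<^sup>2 * ?v + t \<bullet> (obs_cov *v t)) / 2) =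
      char (resid_law T) s * charfn (mvn (obs m) obs_cov) t"
    unfolding char_normal_law[OF var_nonneg] charfn_mvn[OF pos_def_obs_cov] exp_add[symmetric]
    by (rule arg_cong[where f=exp])
       (simp add: blinfun.add_left blinfun.scaleR_left comb_apply field_simps)
  also have "char (resid_law T) s = charfn (resid_law T) s"
    by (simp add: char_def charfn_def)
  finally show "charfn (distr M borel (\<lambda>\<omega>. (blinfun_apply (resid T) (F \<omega>), obs (F \<omega>)))) z =
      charfn (resid_law T \<Otimes>\<^sub>M mvn (obs m) obs_cov) z"
    by (simp add: charfn_pair_measure[OF fin sets_resid_law s] z)
qed simp

end

section \<open>The reweighted measure and its disintegration\<close>

locale reweighted_gaussian = observed_gaussian M F m C L
  for M :: "'a measure" and F :: "'a \<Rightarrow> 'e::{banach, second_countable_topology}" and m C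
    and L :: "'k::finite \<Rightarrow> ('e \<Rightarrow>\<^sub>L real)" +
  fixes \<mu> :: "real^'k" and \<Sigma> :: "real^'k^'k"
  assumes pos_def: "pos_def_matrix \<Sigma>"
begin

text \<open>An explicit, everywhere defined version of dQ^L/dP^L. \<open>RN_deriv\<close> is fixed
  only up to null sets, so the computations use this version.\<close>

definition weight :: "real^'k \<Rightarrow> real" where
  "weight u = mvn_density \<mu> \<Sigma> u / mvn_density (obs m) obs_cov u"

definition posterior :: "'e measure" where
  "posterior = density (distr M borel F) (\<lambda>f. ennreal (weight (obs f)))"

lemma measurable_weight [measurable]: "weight \<in> borel_measurable borel"
  unfolding weight_def[abs_def] by measurable

lemma sets_posterior [simp]: "sets posterior = sets borel" and space_posterior [simp]: "space posterior = UNIV"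
  by (simp_all add: posterior_def)

lemma measurable_posterior [simp]: "measurable posterior N = measurable borel N"
  by (rule measurable_cong_sets) simp_all

lemma density_weight: "density (distr M borel (\<lambda>\<omega>. obs (F \<omega>))) (\<lambda>u. ennreal (weight u)) = mvn \<mu> \<Sigma>"
  unfolding distr_obs weight_def by (rule mvn_eq_density_mvn[OF pos_def_obs_cov, symmetric])

text \<open>Uniqueness of Radon-Nikodym derivatives gives agreement almost everywhere for P^L, which
  is the image of the law of F under \<open>obs\<close>; the agreement therefore pulls back to that
  law.\<close>

lemma posterior_eq_density_RN_deriv:
  "posterior = density (distr M borel F) (\<lambda>f. RN_deriv (distr M borel (\<lambda>\<omega>. obs (F \<omega>))) (mvn \<mu> \<Sigma>) (obs f))"
proof -
  let ?PL = "distr M borel (\<lambda>\<omega>. obs (F \<omega>))"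
  interpret PL: prob_space ?PL by (rule prob_space_distr) simp
  have "AE u in ?PL. ennreal (weight u) = RN_deriv ?PL (mvn \<mu> \<Sigma>) u"
    by (rule PL.RN_deriv_unique) (simp_all add: density_weight)
  then have "AE f in distr M borel F. ennreal (weight (obs f)) = RN_deriv ?PL (mvn \<mu> \<Sigma>) (obs f)"
    by (simp add: AE_distr_iff)
  then show ?thesis
    unfolding posterior_def by (intro density_cong) simp_all
qed

text \<open>The defining identity of the kernel says that the law of the observations, restricted to
  the event F \<in> A, has density \<open>measure (\<kappa> u) A\<close> with respect to P^L.
  Integrating \<open>weight\<close> against both descriptions, and absorbing it into P^L to form
  Q^L, gives the mixture.\<close>

lemma emeasure_posterior_eq_mixture:
  assumes \<kappa>: "reg_cond_distr M F (\<lambda>\<omega>. obs (F \<omega>)) \<kappa>" and A [measurable]: "A \<in> sets borel"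
  shows "emeasure posterior A = (\<integral>\<^sup>+ u. ennreal (measure (\<kappa> u) A) \<partial>mvn \<mu> \<Sigma>)"
proof -
  let ?PL = "distr M borel (\<lambda>\<omega>. obs (F \<omega>))"
  interpret PL: prob_space ?PL by (rule prob_space_distr) simp
  have k [measurable]: "(\<lambda>u. measure (\<kappa> u) A) \<in> borel_measurable borel"
    using \<kappa> A by (simp add: reg_cond_distr_def)
  have k1: "measure (\<kappa> u) A \<le> 1" for u
    using \<kappa> by (simp add: reg_cond_distr_def prob_space.prob_le_1)
  have eq: "distr (density M (\<lambda>\<omega>. indicator A (F \<omega>))) borel (\<lambda>\<omega>. obs (F \<omega>)) =
      density ?PL (\<lambda>u. ennreal (measure (\<kappa> u) A))"
  proof (rule measure_eqI)
    fix B assume "B \<in> sets (distr (density M (\<lambda>\<omega>. indicator A (F \<omega>))) borel (\<lambda>\<omega>. obs (F \<omega>)))"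
    then have B [measurable]: "B \<in> sets borel" by simp
    have "emeasure (distr (density M (\<lambda>\<omega>. indicator A (F \<omega>))) borel (\<lambda>\<omega>. obs (F \<omega>))) B =
        (\<integral>\<^sup>+\<omega>. indicator {\<omega> \<in> space M. F \<omega> \<in> A \<and> obs (F \<omega>) \<in> B} \<omega> \<partial>M)"
      by (subst emeasure_distr, simp, simp, subst emeasure_density)
         (auto intro!: nn_integral_cong measurable_sets split: split_indicator simp del: nn_integral_indicator)
    also have "\<dots> = ennreal (measure M {\<omega> \<in> space M. F \<omega> \<in> A \<and> obs (F \<omega>) \<in> B})"
      by (simp add: emeasure_eq_measure)
    also have "\<dots> = ennreal (\<integral>u. indicator B u * measure (\<kappa> u) A \<partial>?PL)"
      using \<kappa> A B by (simp add: reg_cond_distr_def)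
    \<comment> \<open>The bound by 1 makes the integrand integrable over a probability space, so the
      Bochner integral in the definition of the kernel agrees with the nonnegative one.\<close>
    also have "\<dots> = (\<integral>\<^sup>+u. ennreal (indicator B u * measure (\<kappa> u) A) \<partial>?PL)"
      using k1 by (intro nn_integral_eq_integral[symmetric] PL.integrable_const_bound[of _ 1])
        (auto split: split_indicator)
    also have "\<dots> = emeasure (density ?PL (\<lambda>u. ennreal (measure (\<kappa> u) A))) B"
      by (simp add: emeasure_density) (auto intro!: nn_integral_cong split: split_indicator)
    finally show "emeasure (distr (density M (\<lambda>\<omega>. indicator A (F \<omega>))) borel (\<lambda>\<omega>. obs (F \<omega>))) B =
        emeasure (density ?PL (\<lambda>u. ennreal (measure (\<kappa> u) A))) B" .
  qed simp
  have "emeasure posterior A = (\<integral>\<^sup>+\<omega>. indicator A (F \<omega>) * ennreal (weight (obs (F \<omega>))) \<partial>M)"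
    by (simp add: posterior_def emeasure_density nn_integral_distr mult.commute)
  also have "\<dots> = (\<integral>\<^sup>+u. ennreal (weight u) \<partial>distr (density M (\<lambda>\<omega>. indicator A (F \<omega>))) borel (\<lambda>\<omega>. obs (F \<omega>)))"
    by (simp add: nn_integral_distr nn_integral_density)
  also have "\<dots> = (\<integral>\<^sup>+u. ennreal (weight u) * ennreal (measure (\<kappa> u) A) \<partial>?PL)"
    unfolding eq by (subst nn_integral_density) (simp_all add: mult.commute)
  also have "\<dots> = (\<integral>\<^sup>+u. ennreal (measure (\<kappa> u) A) \<partial>mvn \<mu> \<Sigma>)"
    unfolding density_weight[symmetric] by (subst nn_integral_density) simp_all
  finally show ?thesis .
qed

text \<open>The weight depends on the second coordinate alone. On the product law it is thus the
  product of the densities 1 and \<open>weight\<close>, and only the observation factor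
  changes.\<close>

lemma distr_posterior_resid_obs:
  "distr posterior borel (\<lambda>f. (blinfun_apply (resid T) f, obs f)) = resid_law T \<Otimes>\<^sub>M mvn \<mu> \<Sigma>"
proof -
  let ?\<Phi> = "\<lambda>f. (blinfun_apply (resid T) f, obs f)"
  interpret R: prob_space "resid_law T" by (rule prob_space_resid_law)
  interpret PL: prob_space "mvn (obs m) obs_cov" by (rule prob_space_mvn[OF pos_def_obs_cov])
  interpret QL: prob_space "mvn \<mu> \<Sigma>" by (rule prob_space_mvn[OF pos_def])
  have [measurable_cong]: "sets (mvn (obs m) obs_cov) = sets borel"
    by (simp add: mvn_def)
  have w: "mvn \<mu> \<Sigma> = density (mvn (obs m) obs_cov) (\<lambda>u. ennreal (weight u))"
    by (simp add: density_weight[symmetric] distr_obs)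
  have "(\<lambda>z. ennreal (weight (snd z))) \<in> borel_measurable (borel \<Otimes>\<^sub>M borel :: (real \<times> (real^'k)) measure)"
    by measurable
  then have [measurable]: "(\<lambda>z :: real \<times> (real^'k). ennreal (weight (snd z))) \<in> borel_measurable borel"
    by (simp only: borel_prod)
  have "distr posterior borel ?\<Phi> = density (distr (distr M borel F) borel ?\<Phi>) (\<lambda>z. ennreal (weight (snd z)))"
    unfolding posterior_def by (subst density_distr[where N=borel and X="?\<Phi>"]) simp_all
  also have "distr (distr M borel F) borel ?\<Phi> = resid_law T \<Otimes>\<^sub>M mvn (obs m) obs_cov"
    by (subst distr_distr) (simp_all add: o_def distr_resid_obs)
  also have "density (resid_law T \<Otimes>\<^sub>M mvn (obs m) obs_cov) (\<lambda>z. ennreal (weight (snd z))) =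
      density (resid_law T) (\<lambda>_. 1) \<Otimes>\<^sub>M density (mvn (obs m) obs_cov) (\<lambda>u. ennreal (weight u))"
    by (subst pair_measure_density)
       (simp_all add: case_prod_beta' w[symmetric] QL.sigma_finite_measure_axioms PL.sigma_finite_measure_axioms)
  also have "\<dots> = resid_law T \<Otimes>\<^sub>M mvn \<mu> \<Sigma>"
    by (simp add: density_1 w)
  finally show ?thesis .
qed

text \<open>A measure and its image have the same total mass, and the image just computed is a
  product of probability measures. The functional 0 is an arbitrary choice.\<close>

lemma prob_space_posterior: "prob_space posterior"
proof (rule prob_space_distrD)
  show "(\<lambda>f. (blinfun_apply (resid 0) f, obs f)) \<in> measurable posterior borel" by simp
  interpret R: prob_space "resid_law 0" by (rule prob_space_resid_law)
  interpret QL: prob_space "mvn \<mu> \<Sigma>" by (rule prob_space_mvn[OF pos_def])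
  interpret pair_prob_space "resid_law 0" "mvn \<mu> \<Sigma>" ..
  show "prob_space (distr posterior borel (\<lambda>f. (blinfun_apply (resid 0) f, obs f)))"
    unfolding distr_posterior_resid_obs by (rule prob_space_axioms)
qed

section \<open>Mean and covariance of the reweighted measure\<close>

text \<open>The correction is a value of \<open>C\<close>, hence a vector of E. Applying
  \<open>T\<close> to it gives, by \<open>cov_comb\<close>, the inner product of C_LT with C_LL^-1
  (\<mu> - (m, L)).\<close>

definition posterior_mean :: 'e where
  "posterior_mean = m + C (comb (matrix_inv obs_cov *v (\<mu> - obs m)))"

text \<open>The outer \<open>C (comb ...)\<close> again places the correction in E; applying
  \<open>T'\<close> to it produces the factor C_LT', while \<open>gain T\<close> supplies the other
  side of the bilinear form.\<close>

definition posterior_cov :: "('e \<Rightarrow>\<^sub>L real) \<Rightarrow> 'e" where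
  "posterior_cov T = C T + C (comb (matrix_inv obs_cov *v ((\<Sigma> - obs_cov) *v gain T)))"

lemma inner_inv_obs_cov: "(matrix_inv obs_cov *v x) \<bullet> y = x \<bullet> (matrix_inv obs_cov *v y)"
  by (metis inner_transpose_matrix transpose_inv_obs_cov)

lemma apply_posterior_mean: "blinfun_apply T posterior_mean = blinfun_apply T m + gain T \<bullet> (\<mu> - obs m)"
  by (simp add: posterior_mean_def blinfun.add_right cov_comb gain_def) (metis inner_commute inner_inv_obs_cov)

lemma inner_cov_diff_commute: "x \<bullet> ((\<Sigma> - obs_cov) *v y) = y \<bullet> ((\<Sigma> - obs_cov) *v x)"
proof -
  have "transpose (\<Sigma> - obs_cov) = \<Sigma> - obs_cov"
    using pos_def transpose_obs_cov by (simp add: pos_def_matrix_def transpose_def vec_eq_iff)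
  then show ?thesis by (metis inner_commute inner_transpose_matrix)
qed

lemma apply_posterior_cov: "blinfun_apply T' (posterior_cov T) = blinfun_apply T' (C T) + gain T \<bullet> ((\<Sigma> - obs_cov) *v gain T')"
  by (simp add: posterior_cov_def blinfun.add_right cov_comb inner_inv_obs_cov gain_def[symmetric])
     (metis inner_commute inner_cov_diff_commute)

text \<open>The form of C_LL at \<open>gain T\<close> is the part of the variance explained by the
  observations. Subtracting it from the prior variance leaves the residual variance, so the right
  side is the variance of an independent sum.\<close>

lemma apply_posterior_cov_same:
  "blinfun_apply T (posterior_cov T) = blinfun_apply (resid T) (C (resid T)) + gain T \<bullet> (\<Sigma> *v gain T)"
  by (simp add: apply_posterior_cov var_resid matrix_vector_mult_diff_rdistrib obs_cov_gain inner_diff_right)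

lemma apply_posterior_cov_nonneg: "0 \<le> blinfun_apply T (posterior_cov T)"
proof -
  have "0 \<le> gain T \<bullet> (\<Sigma> *v gain T)"
    using pos_def by (cases "gain T = 0") (auto simp: pos_def_matrix_def less_imp_le)
  then show ?thesis using var_nonneg[of "resid T"] by (simp add: apply_posterior_cov_same)
qed

lemma distr_posterior_functional:
  "distr posterior borel (blinfun_apply T) = normal_law (blinfun_apply T posterior_mean) (blinfun_apply T (posterior_cov T))"
proof (rule normal_law_eqI_char)
  show "prob_space (distr posterior borel (blinfun_apply T))"
    by (rule prob_space.prob_space_distr[OF prob_space_posterior]) simp
  fix s
  have QL: "sets (mvn \<mu> \<Sigma>) = sets borel" by (simp add: mvn_def)
  have "char (distr posterior borel (blinfun_apply T)) s = (CLINT f|posterior. iexp (s * blinfun_apply T f))"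
    unfolding char_def by (subst integral_distr) simp_all
  \<comment> \<open>Since \<open>T\<close> is \<open>resid T\<close> plus the combination of
    observations with coefficients \<open>gain T\<close>, frequency \<open>s\<close> for
    \<open>T\<close> is the frequency pair \<open>(s, s *\<^sub>R gain T)\<close>.\<close>
  also have "\<dots> = charfn (distr posterior borel (\<lambda>f. (blinfun_apply (resid T) f, obs f))) (s, s *\<^sub>R gain T)"
    unfolding charfn_def
    by (subst integral_distr) (simp_all add: resid_apply algebra_simps)
  also have "\<dots> = char (resid_law T) s * charfn (mvn \<mu> \<Sigma>) (s *\<^sub>R gain T)"
    unfolding distr_posterior_resid_obs
    using charfn_pair_measure[OF prob_space.finite_measure[OF prob_space_resid_law[of T]]
      prob_space.finite_measure[OF prob_space_mvn[OF pos_def]] sets_resid_law QL]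
    by (simp add: char_def charfn_def)
  also have "\<dots> = exp (\<i> * of_real (s * blinfun_apply T posterior_mean) - of_real (s\<^sup>2 * blinfun_apply T (posterior_cov T)) / 2)"
    unfolding char_normal_law[OF var_nonneg] charfn_mvn[OF pos_def] exp_add[symmetric] apply_posterior_cov_same
    by (rule arg_cong[where f=exp])
       (simp add: apply_posterior_mean resid_apply matrix_vector_mult_scaleR inner_diff_right field_simps power2_eq_square)
  finally show "char (distr posterior borel (blinfun_apply T)) s =
    exp (\<i> * of_real (s * blinfun_apply T posterior_mean) - of_real (s\<^sup>2 * blinfun_apply T (posterior_cov T)) / 2)" .
qed (simp_all add: apply_posterior_cov_nonneg)

lemma gaussian_measure_posterior: "gaussian_measure posterior"
  unfolding gaussian_measure_def real_gaussian_iff_normal_law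
  using prob_space_posterior distr_posterior_functional apply_posterior_cov_nonneg by auto

lemma is_mean_measure_posterior: "is_mean_measure posterior posterior_mean"
  unfolding is_mean_measure_def is_mean_re_def
proof
  fix T :: "'e \<Rightarrow>\<^sub>L real"
  show "integrable posterior (blinfun_apply T) \<and> blinfun_apply T posterior_mean = integral\<^sup>L posterior (blinfun_apply T)"
    using integrable_normal_law[OF apply_posterior_cov_nonneg, of "blinfun_apply T posterior_mean" T]
      integral_normal_law[OF apply_posterior_cov_nonneg, of "blinfun_apply T posterior_mean" T]
    unfolding distr_posterior_functional[symmetric] by (simp add: integrable_distr_eq integral_distr)
qed

lemma is_cov_measure_posterior: "is_cov_measure posterior posterior_mean posterior_cov"
  unfolding is_cov_measure_def is_cov_re_def
proof (intro allI)
  fix x y :: "'e \<Rightarrow>\<^sub>L real"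
  define d where "d T f = (blinfun_apply T f - blinfun_apply T posterior_mean)\<^sup>2" for T :: "'e \<Rightarrow>\<^sub>L real" and f
  have int: "integrable posterior (d T)" and var: "integral\<^sup>L posterior (d T) = blinfun_apply T (posterior_cov T)" for T
    using integrable_normal_law_square[OF apply_posterior_cov_nonneg, of "blinfun_apply T posterior_mean" T]
      variance_normal_law[OF apply_posterior_cov_nonneg, of "blinfun_apply T posterior_mean" T]
    unfolding distr_posterior_functional[symmetric] d_def[abs_def] by (simp_all add: integrable_distr_eq integral_distr)
  have pol: "(blinfun_apply x f - blinfun_apply x posterior_mean) * (blinfun_apply y f - blinfun_apply y posterior_mean) =
      (d (x + y) f - d (x - y) f) / 4" for f
    by (simp add: d_def blinfun.add_left blinfun.diff_left power2_eq_square field_simps)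
  \<comment> \<open>Expanding the quadratic form at \<open>x + y\<close> and \<open>x - y\<close>
    requires additivity in the argument of \<open>posterior_cov\<close>. Symmetry shifts the sums to
    the applied functional, where additivity is immediate.\<close>
  have sym: "blinfun_apply T (posterior_cov T') = blinfun_apply T' (posterior_cov T)" for T T'
    by (metis apply_posterior_cov cov_sym inner_cov_diff_commute)
  have "blinfun_apply (x + y) (posterior_cov (x + y)) - blinfun_apply (x - y) (posterior_cov (x - y)) = 4 * blinfun_apply y (posterior_cov x)"
    using sym[of x "x + y"] sym[of y "x + y"] sym[of x "x - y"] sym[of y "x - y"] sym[of x y]
    by (simp add: blinfun.add_left blinfun.diff_left)
  then show "integrable posterior (\<lambda>f. (blinfun_apply x f - blinfun_apply x posterior_mean) * (blinfun_apply y f - blinfun_apply y posterior_mean)) \<and>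
    blinfun_apply y (posterior_cov x) = (\<integral>f. (blinfun_apply x f - blinfun_apply x posterior_mean) * (blinfun_apply y f - blinfun_apply y posterior_mean) \<partial>posterior)"
    unfolding pol using int var by simp
qed

end

text \<open>A regular conditional distribution is determined only up to P^L-null sets, so (1) is
  stated for every version; absolute continuity of Q^L with respect to P^L makes the integral
  independent of the version. As covariances are symmetric, the one vector \<open>CTL\<close> serves
  both as C_TL and as C_LT.\<close>

theorem theorem3:
  fixes M :: "'a measure"
    and F :: "'a \<Rightarrow> 'e::{banach, second_countable_topology}"
    and m :: 'e
    and C :: "('e \<Rightarrow>\<^sub>L real) \<Rightarrow> 'e"
    and L :: "'k::finite \<Rightarrow> ('e \<Rightarrow>\<^sub>L real)"
    and \<mu> :: "real^'k"
    and \<Sigma> :: "real^'k^'k"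
    and P :: "'e measure" and PL QL :: "(real^'k) measure"
    and Lv :: "'e \<Rightarrow> real^'k" and U :: "'a \<Rightarrow> real^'k"
    and CLL :: "real^'k^'k" and mL :: "real^'k"
    and CTL :: "('e \<Rightarrow>\<^sub>L real) \<Rightarrow> real^'k"
    and Q :: "'e measure"
  assumes gauss: "gaussian_random_element M F"
    and mean: "is_mean_re M F m"
    and cov: "is_cov_re M F m C"
    and P_def: "P \<equiv> distr M borel F"
    and Lv_def: "Lv \<equiv> (\<lambda>f. \<chi> j. blinfun_apply (L j) f)"
    and U_def: "U \<equiv> (\<lambda>\<omega>. Lv (F \<omega>))"
    and CLL_def: "CLL \<equiv> (\<chi> i j. blinfun_apply (L j) (C (L i)))"
    and mL_def: "mL \<equiv> (\<chi> j. blinfun_apply (L j) m)"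
    and CTL_def: "CTL \<equiv> (\<lambda>T. \<chi> j. blinfun_apply (L j) (C T))"
    and inv: "invertible CLL"
    and PL_def: "PL \<equiv> distr M borel U"
    and Sigma_pd: "pos_def_matrix \<Sigma>"
    and QL_def: "QL \<equiv> mvn \<mu> \<Sigma>"
    and Q_def: "Q \<equiv> density P (\<lambda>f. RN_deriv PL QL (Lv f))"
  shows "(\<forall>\<kappa>. reg_cond_distr M F U \<kappa> \<longrightarrow>
            (\<forall>A \<in> sets borel. emeasure Q A = (\<integral>\<^sup>+ u. ennreal (measure (\<kappa> u) A) \<partial>QL)))
       \<and> (\<exists>mQ CQ. gaussian_measure Q \<and> is_mean_measure Q mQ \<and> is_cov_measure Q mQ CQ
            \<and> (\<forall>T. blinfun_apply T mQ = blinfun_apply T m + CTL T \<bullet> (matrix_inv CLL *v (\<mu> - mL)))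
            \<and> (\<forall>T T'. blinfun_apply T' (CQ T) = blinfun_apply T' (C T)
                 + CTL T \<bullet> (matrix_inv CLL *v ((\<Sigma> - CLL) *v (matrix_inv CLL *v CTL T')))))"
proof -
  interpret G: reweighted_gaussian M F m C L \<mu> \<Sigma>
    by unfold_locales (use gauss mean cov inv Sigma_pd in \<open>simp_all add: CLL_def\<close>)
  have Lv: "Lv = G.obs" and CLL: "CLL = G.obs_cov"
    by (simp_all add: Lv_def G.obs_def[abs_def] CLL_def G.obs_cov_def)
  have mL: "mL = G.obs m" and CTL: "CTL T = G.obs (C T)" for T
    by (simp_all add: mL_def CTL_def G.obs_def)
  have Q: "Q = G.posterior"
    unfolding G.posterior_eq_density_RN_deriv by (simp add: Q_def P_def PL_def QL_def U_def Lv)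
  have gain: "matrix_inv CLL *v CTL T = G.gain T" for T
    by (simp add: CLL CTL G.gain_def)
  \<comment> \<open>The inverse of C_LL is symmetric and may be moved onto \<open>CTL T\<close>,
    where it forms the gain; this puts both formulas in the shape already established.\<close>
  have inner: "CTL T \<bullet> (matrix_inv CLL *v x) = G.gain T \<bullet> x" for T x
    by (simp add: gain[symmetric] CLL G.inner_inv_obs_cov)
  show ?thesis
  proof (intro conjI exI allI impI ballI)
    fix \<kappa> and A :: "'e set" assume "reg_cond_distr M F U \<kappa>" "A \<in> sets borel"
    then show "emeasure Q A = (\<integral>\<^sup>+ u. ennreal (measure (\<kappa> u) A) \<partial>QL)"
      unfolding Q QL_def by (intro G.emeasure_posterior_eq_mixture) (simp_all add: U_def Lv)
  next
    show "gaussian_measure Q" "is_mean_measure Q G.posterior_mean"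
      "is_cov_measure Q G.posterior_mean G.posterior_cov"
      unfolding Q
      by (rule G.gaussian_measure_posterior G.is_mean_measure_posterior G.is_cov_measure_posterior)+
    show "blinfun_apply T G.posterior_mean = blinfun_apply T m + CTL T \<bullet> (matrix_inv CLL *v (\<mu> - mL))" for T
      by (simp add: G.apply_posterior_mean inner mL)
    show "blinfun_apply T' (G.posterior_cov T) = blinfun_apply T' (C T)
        + CTL T \<bullet> (matrix_inv CLL *v ((\<Sigma> - CLL) *v (matrix_inv CLL *v CTL T')))" for T T'
      by (simp add: G.apply_posterior_cov inner gain) (simp add: CLL)
  qed
qed

end
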